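(* Suppose that $\boldsymbol\xi\sim P$ satisfies density-level regular variation with index $s$, that $(L_1,\dots,L_K)\in\mathcal H_1$ is regular, that $\mathcal J\in\mathfrak J$ is a nonempty subset of $[K]$ under consideration, and that the estimation-rate assumption (with exponents $m,\ell\in(0,1/2]$) and the second-order assumption (with exponent $\gamma>0$) hold. Consider the upper bound $\mathsf{TV}(\widehat\Pi_n,\Pi_n)=O_P\big(n^{-(1-q)(m\wedge\ell)}+n^{-q\gamma/s}\big)$, whose polynomial exponent is $e(q)=\min\{(1-q)(m\wedge\ell),\,q\gamma/s\}$. The choice $$q^\star=\frac{s(m\wedge\ell)}{\gamma+s(m\wedge\ell)}$$ balances the two terms, i.e. $(1-q^\star)(m\wedge\ell)=q^\star\gamma/s$, and for $q=q^\star$, $$\mathsf{TV}\big(\widehat\Pi_n,\Pi_n\big)=O_P\!\left(n^{-\frac{\gamma(m\wedge\ell)}{\gamma+s(m\wedge\ell)}}\right).$$ Any other fixed $q\in(0,1)$, $q\ne q^\star$, gives a strictly smaller polynomial exponent in the upper bound: $e(q)<e(q^\star)$.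
   Context: Setting. $\|\cdot\|$ is the Euclidean norm on $\mathbb R^d$; $\mathcal E\subset\mathbb R^d$ is a closed cone; $\Theta_{\mathcal E}=\{\boldsymbol z\in\mathcal E:\|\boldsymbol z\|=1\}$; $B_r=\{\boldsymbol z:\|\boldsymbol z\|\le r\}$; $d\boldsymbol\phi$ is surface measure on $\Theta_{\mathcal E}$, so $d\boldsymbol z=r^{d-1}\,dr\,d\boldsymbol\phi$ for $\boldsymbol z=r\boldsymbol\phi$. $\boldsymbol\xi\sim P$ has density $f_{\boldsymbol\xi}$ supported on $\mathcal E$; $R=\|\boldsymbol\xi\|$, $\boldsymbol\Phi=\boldsymbol\xi/\|\boldsymbol\xi\|$. $[K]=\{1,\dots,K\}$. $\mathsf{TV}(P,Q)=\sup_B|P(B)-Q(B)|$. Density-level regular variation: $f_{\boldsymbol\xi}$ is continuous on $B_{r_0}^c\cap\mathcal E$ for some $r_0>0$, and there are $s>0$ and $\varphi^\star:\mathcal E\setminus\{\boldsymbol 0\}\to(0,\infty)$ with $t^{s+d}f_{\boldsymbol\xi}(t\boldsymbol z)\to\varphi^\star(\boldsymbol z)$ as $t\to\infty$, uniformly over compact subsets of $\mathcal E\setminus\{\boldsymbol 0\}$. Second-order assumption: moreover there is $\gamma>0$ with $\sup_{r>t,\ \boldsymbol\phi\in\Theta_{\mathcal E}}|r^{s+d}f_{\boldsymbol\xi}(r\boldsymbol\phi)-\varphi^\star(\boldsymbol\phi)|=O(t^{-\gamma})$ as $t\to\infty$. Loss systems: measurable functions $L_1,\dots,L_K:\mathcal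 E\to\mathbb R$ form an asymptotically homogeneous multi-loss system, $(L_1,\dots,L_K)\in\mathcal H_1$, if for each $j$ there is $L_j^\star:\mathcal E\to\mathbb R$ with $\{L_j^\star>0\}\ne\varnothing$ and $t^{-1}L_j(t\boldsymbol z_t)\to L_j^\star(\boldsymbol z)$ whenever $t\to\infty$ and $\boldsymbol z_t\to\boldsymbol z$ in $\mathcal E$. $\mathcal S(u;\mathcal J)=\{\boldsymbol z\in\mathcal E:L_j(\boldsymbol z)\ge u\ \forall j\in\mathcal J\}$, $\mathcal S^\star(\mathcal J)=\{\boldsymbol z\in\mathcal E:L_j^\star(\boldsymbol z)\ge1\ \forall j\in\mathcal J\}$. $\mathfrak J$ is the collection of nonempty subsets of $[K]$ under consideration; the system is regular if $\mathcal S^\star(\mathcal J)$ has nonzero Lebesgue measure for every $\mathcal J\in\mathfrak J$. Data and thresholds: $\boldsymbol\xi_1,\dots,\boldsymbol\xi_n$ are i.i.d. from $P$, $R_i=\|\boldsymbol\xi_i\|$, $R_{(k)}$ is the $k$th largest of $R_1,\dots,R_n$. For $q\in(0,1)$, $k_n=\lfloor n^{1-q}\rfloor$, $t_n=R_{(k_n)}$. Fix $r\ge1$ and let $u_n$ be the $(1-n^{-r})$-quantile of $R$ under $P$. For $t>0$, $\Phi^{(t)}$ denotes the conditional law of $\boldsymbol\Phi$ given $\{R>t\}$, with density $\varphi^{(t)}$ w.r.t. $d\boldsymbol\phi$; $\Phi^{(t_n)}$ is this law at $t=t_n$. Estimation-rate assumption: $\widehat s_{t_n}>0$ and a probability law $\widehat\Phi^{(t_n)}$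 on $\Theta_{\mathcal E}$ with density $\widehat\varphi^{(t_n)}$ w.r.t. $d\boldsymbol\phi$ are estimators built from the observations with $R_i\ge t_n$ such that, for some $m,\ell\in(0,1/2]$, $|\widehat s_{t_n}-s|=O_P(k_n^{-m})$ and $\mathsf{TV}(\Phi^{(t_n)},\widehat\Phi^{(t_n)})=O_P(k_n^{-\ell})$. Data-driven SSGEN law $\widehat P_{\rm gen}^{(t_n)}$: the (data-dependent) law which on $\{\|\boldsymbol x\|>t_n\}$ has total mass $\widehat p_{t_n}=k_n/n$ and radial–angular density (w.r.t. $dr\,d\boldsymbol\phi$) $\widehat p_{t_n}\,\widehat s_{t_n}\,t_n^{\widehat s_{t_n}}\,r^{-(\widehat s_{t_n}+1)}\,\widehat\varphi^{(t_n)}(\boldsymbol\phi)$, $r>t_n$, the remaining mass (the body) being carried by $\{\|\boldsymbol x\|\le t_n\}$ (e.g. the empirical distribution of the data there). Stressed laws: $\Pi_n=\mathsf{Law}(u_n^{-1}\boldsymbol\xi\mid\boldsymbol\xi\in\mathcal S(u_n;\mathcal J))$ with $\boldsymbol\xi\sim P$, and (conditionally on the data) $\widehat\Pi_n=\mathsf{Law}(u_n^{-1}\widehat{\boldsymbol\xi}_n\mid\widehat{\boldsymbol\xi}_n\in\mathcal S(u_n;\mathcal J))$ with $\widehat{\boldsymbol\xi}_n\sim\widehat P_{\rm gen}^{(t_n)}$ (defined arbitrarily when the conditioning event has probability zero). *)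

theory Defs
  imports "HOL-Probability.Probability"
begin

definition unit_directions :: "'a::euclidean_space set \<Rightarrow> 'a set" where
  "unit_directions E = {z \<in> E. norm z = 1}"

(* Surface measure of the unit sphere, normalised so that dz = r^(d-1) dr dphi: the measure of
   A is d times the Lebesgue measure of {z. norm z \<le> 1 and z / norm z \<in> A}.  The origin, where
   sgn z = z / norm z equals 0, is a null set. *)
definition sphere_surface :: "'a::euclidean_space measure" where
  "sphere_surface =
     scale_measure (of_nat DIM('a)) (distr (restrict_space lborel (cball 0 1)) borel sgn)"

(* A measure on all Borel sets of the ambient space, concentrated on the unit directions of E. *)
definition surface_measure :: "'a::euclidean_space set \<Rightarrow> 'a measure" where
  "surface_measure E = density sphere_surface (indicator (unit_directions E))"

definition supported_density :: "'a::euclidean_space set \<Rightarrow> ('a \<Rightarrow> real) \<Rightarrow> bool" where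
  "supported_density E f \<longleftrightarrow>
     f \<in> borel_measurable borel \<and> (\<forall>x. 0 \<le> f x) \<and> (\<forall>x. x \<notin> E \<longrightarrow> f x = 0) \<and>
     prob_space (density lborel f)"

definition density_regularly_varying ::
  "'a::euclidean_space set \<Rightarrow> ('a \<Rightarrow> real) \<Rightarrow> real \<Rightarrow> ('a \<Rightarrow> real) \<Rightarrow> bool" where
  "density_regularly_varying E f s phi_star \<longleftrightarrow>
     s > 0 \<and> (\<exists>r0>0. continuous_on (E - cball 0 r0) f) \<and> (\<forall>z\<in>E - {0}. phi_star z > 0) \<and>
     (\<forall>C. compact C \<and> C \<subseteq> E - {0} \<longrightarrow>
        uniform_limit C (\<lambda>t z. t powr (s + real DIM('a)) * f (t *\<^sub>R z)) phi_star at_top)"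

(* The bound on the supremum over r > t and phi is written pointwise, because Sup on the reals
   is meaningless for sets that are not bounded above. *)
definition second_order_condition ::
  "'a::euclidean_space set \<Rightarrow> ('a \<Rightarrow> real) \<Rightarrow> real \<Rightarrow> ('a \<Rightarrow> real) \<Rightarrow> real \<Rightarrow> bool" where
  "second_order_condition E f s phi_star \<gamma> \<longleftrightarrow>
     \<gamma> > 0 \<and>
     (\<exists>C. \<forall>\<^sub>F t in at_top. \<forall>r>t. \<forall>\<phi>\<in>unit_directions E.
        \<bar>r powr (s + real DIM('a)) * f (r *\<^sub>R \<phi>) - phi_star \<phi>\<bar> \<le> C * t powr (- \<gamma>))"

definition asymptotically_homogeneous_system ::
  "'a::euclidean_space set \<Rightarrow> nat \<Rightarrow> (nat \<Rightarrow> 'a \<Rightarrow> real) \<Rightarrow> (nat \<Rightarrow> 'a \<Rightarrow> real) \<Rightarrow> bool" where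
  "asymptotically_homogeneous_system E K L Lstar \<longleftrightarrow>
     (\<forall>j\<in>{1..K}.
        L j \<in> borel_measurable (restrict_space borel E) \<and>
        (\<exists>z\<in>E. Lstar j z > 0) \<and>
        (\<forall>z\<in>E. \<forall>w :: real \<Rightarrow> 'a. (\<forall>t. w t \<in> E) \<and> (w \<longlongrightarrow> z) at_top \<longrightarrow>
           ((\<lambda>t. L j (t *\<^sub>R w t) / t) \<longlongrightarrow> Lstar j z) at_top))"

definition stress_set ::
  "'a::euclidean_space set \<Rightarrow> (nat \<Rightarrow> 'a \<Rightarrow> real) \<Rightarrow> real \<Rightarrow> nat set \<Rightarrow> 'a set" where
  "stress_set E L u J = {z \<in> E. \<forall>j\<in>J. L j z \<ge> u}"

(* With the limit losses at level 1, stress_set is the limiting stress set. *)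
definition regular_system ::
  "'a::euclidean_space set \<Rightarrow> (nat \<Rightarrow> 'a \<Rightarrow> real) \<Rightarrow> nat set set \<Rightarrow> bool" where
  "regular_system E Lstar JJ \<longleftrightarrow> (\<forall>J\<in>JJ. emeasure lebesgue (stress_set E Lstar 1 J) \<noteq> 0)"

definition sample :: "(nat \<Rightarrow> 'w \<Rightarrow> 'a) \<Rightarrow> nat \<Rightarrow> 'w \<Rightarrow> 'a list" where
  "sample \<xi> n \<omega> = map (\<lambda>i. \<xi> i \<omega>) [1..<Suc n]"

definition kth_largest :: "nat \<Rightarrow> real list \<Rightarrow> real" where
  "kth_largest k xs = rev (sort xs) ! (k - 1)"

definition num_exceed :: "real \<Rightarrow> nat \<Rightarrow> nat" where
  "num_exceed q n = nat \<lfloor>real n powr (1 - q)\<rfloor>"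

definition threshold :: "real \<Rightarrow> nat \<Rightarrow> 'a::euclidean_space list \<Rightarrow> real" where
  "threshold q n xs = kth_largest (num_exceed q n) (map norm xs)"

definition tail_sample :: "real \<Rightarrow> nat \<Rightarrow> 'a::euclidean_space list \<Rightarrow> 'a list" where
  "tail_sample q n xs = filter (\<lambda>x. threshold q n xs \<le> norm x) xs"

definition quantile :: "real measure \<Rightarrow> real \<Rightarrow> real" where
  "quantile D \<alpha> = Inf {x. \<alpha> \<le> cdf D x}"

definition stress_level :: "'a::euclidean_space measure \<Rightarrow> real \<Rightarrow> nat \<Rightarrow> real" where
  "stress_level P r n = quantile (distr P borel norm) (1 - real n powr (- r))"

definition angular_law :: "'a::euclidean_space measure \<Rightarrow> real \<Rightarrow> 'a measure" where
  "angular_law P t = distr (uniform_measure P {x. norm x > t}) borel sgn"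

definition total_variation :: "'a measure \<Rightarrow> 'a measure \<Rightarrow> real" where
  "total_variation P Q = (SUP B\<in>sets P. \<bar>measure P B - measure Q B\<bar>)"

(* X n = O_P(a n), in outer probability: for measurable X n this is the usual requirement that
   the probability of {\<bar>X n\<bar> > C * a n} be eventually at most \<epsilon>, while for a non-measurable
   X n, to whose exceedance set the function measure would assign 0, it stays meaningful. *)
definition bigO_P :: "'w measure \<Rightarrow> (nat \<Rightarrow> 'w \<Rightarrow> real) \<Rightarrow> (nat \<Rightarrow> real) \<Rightarrow> bool" where
  "bigO_P M X a \<longleftrightarrow>
     (\<forall>\<epsilon>>0. \<exists>C. \<forall>\<^sub>F n in sequentially.
        \<exists>A\<in>sets M. measure M A \<ge> 1 - \<epsilon> \<and> (\<forall>\<omega>\<in>A. \<bar>X n \<omega>\<bar> \<le> C * a n))"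

(* The measure with density p s t^s r^(-(s+1)) psi(phi), r > t, with respect to dr dphi. *)
definition polar_tail_measure ::
  "'a::euclidean_space set \<Rightarrow> real \<Rightarrow> real \<Rightarrow> real \<Rightarrow> ('a \<Rightarrow> real) \<Rightarrow> 'a measure" where
  "polar_tail_measure E t p s \<psi> =
     distr
       (density (lborel \<Otimes>\<^sub>M surface_measure E)
          (\<lambda>(r, \<phi>). ennreal (p * s * t powr s * r powr (- (s + 1)) * \<psi> \<phi>) * indicator {t<..} r))
       borel (\<lambda>(r, \<phi>). r *\<^sub>R \<phi>)"

(* The body, on {x. norm x \<le> t}, is left arbitrary apart from its total mass 1 - p. *)
definition ssgen_law ::
  "'a::euclidean_space set \<Rightarrow> real \<Rightarrow> real \<Rightarrow> real \<Rightarrow> ('a \<Rightarrow> real) \<Rightarrow> 'a measure \<Rightarrow> bool" where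
  "ssgen_law E t p s \<psi> Q \<longleftrightarrow>
     prob_space Q \<and> sets Q = sets borel \<and>
     measure Q {x. norm x > t} = p \<and> measure Q {x. norm x \<le> t} = 1 - p \<and>
     (\<forall>A\<in>sets borel. A \<subseteq> {x. norm x > t} \<longrightarrow>
        emeasure Q A = emeasure (polar_tail_measure E t p s \<psi>) A)"

(* Law(x / u | x \<in> S) for x with law Q; D is used when S has probability zero under Q. *)
definition stressed_law ::
  "'a::euclidean_space measure \<Rightarrow> 'a measure \<Rightarrow> real \<Rightarrow> 'a set \<Rightarrow> 'a measure" where
  "stressed_law D Q u S =
     (if measure Q S = 0 then D else distr (uniform_measure Q S) borel (\<lambda>x. x /\<^sub>R u))"

definition rate_exponent :: "real \<Rightarrow> real \<Rightarrow> real \<Rightarrow> real \<Rightarrow> real" where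
  "rate_exponent s \<gamma> \<kappa> q = min ((1 - q) * \<kappa>) (q * \<gamma> / s)"

definition q_star :: "real \<Rightarrow> real \<Rightarrow> real \<Rightarrow> real" where
  "q_star s \<gamma> \<kappa> = s * \<kappa> / (\<gamma> + s * \<kappa>)"

end

theory Submission
  imports Defs "HOL-Real_Asymp.Real_Asymp"
begin

text \<open>In polar coordinates the law \<open>P\<close> has density \<open>r powr (- (s + 1))\<close> times
  \<open>r powr (s + d) * f (r \<phi>)\<close>, and the second factor is within \<open>O(r powr (- \<gamma>))\<close> of the limiting
  angular density. A set \<open>A\<close> of points of norm above \<open>v\<close> is compared under \<open>P\<close> and under the
  estimated law through its angular sections at fixed \<open>r\<close>: each section costs the total variation
  distance of the angular laws plus \<open>O(t powr (- \<gamma>))\<close>, and the two Pareto factors, normalised at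
  their common left endpoint \<open>v\<close>, differ by \<open>\<bar>1 / s - 1 / s'\<bar>\<close> in the mean. Normalising at \<open>v\<close>
  (rather than at \<open>t\<close>) is harmless because constants cancel in the conditional laws, and it
  avoids a logarithmic factor from \<open>(v / t) powr (s - s')\<close>. The stress sets at level \<open>u\<close> lie
  outside a ball of radius \<open>c u\<close>, and by Fatou's lemma their mass is at least of order
  \<open>u powr (- s)\<close>, so the comparison passes to the conditional laws. Finally the threshold is, with
  probability near one, at least of order \<open>n powr (q / s)\<close> and at most \<open>c u\<close>.\<close>

subsection \<open>Polar coordinates\<close>

text \<open>The estimated angular density is controlled only in total variation, never pointwise;
  such a bound is uniform over Borel sets of directions, and so over all sections
  \<open>{\<phi>. r *\<^sub>R \<phi> \<in> A}\<close>. This is why both laws are written as mixtures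
  over \<open>r\<close> of section masses. The second-order condition enters twice, because the
  estimator is compared with the angular law at the finite threshold \<open>t\<close> and not with
  the limit: at \<open>t\<close>, to replace that law by the limit, and at \<open>v\<close>, to
  replace the sections of \<open>P\<close> beyond \<open>v\<close>. The difference of the two
  conditional probabilities is arranged so that only the stress mass under \<open>P\<close> appears
  in a denominator; the generated law may even give the stress set mass zero. The order
  \<open>n powr (q / s)\<close> of the threshold comes from equating a tail of order
  \<open>t powr (- s)\<close> with the fraction \<open>n powr (- q)\<close> of observations kept,
  and it turns \<open>t powr (- \<gamma>)\<close> into \<open>n powr (- (q * \<gamma> / s))\<close>.
  The upper bound by \<open>c * u\<close> puts the stress set where the generated law has its Pareto
  form; it holds because \<open>r \<ge> 1\<close> leaves a bounded expected number of observations
  beyond \<open>c * u\<close>, while \<open>num_exceed q n\<close> tends to infinity.\<close>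

lemma nn_integral_lborel_scale:
  fixes g :: "'a::euclidean_space \<Rightarrow> ennreal"
  assumes [measurable]: "g \<in> borel_measurable borel" and "c > 0"
  shows "(\<integral>\<^sup>+ x. g x \<partial>lborel) = ennreal (c ^ DIM('a)) * (\<integral>\<^sup>+ x. g (c *\<^sub>R x) \<partial>lborel)"
proof -
  have "(\<integral>\<^sup>+ x. g x \<partial>lborel)
      = (\<integral>\<^sup>+ x. g x \<partial>density (distr lborel borel (\<lambda>x. 0 + c *\<^sub>R x)) (\<lambda>_. ennreal (\<bar>c\<bar> ^ DIM('a))))"
    using lborel_affine[of c "0::'a"] \<open>c > 0\<close> by simp
  also have "\<dots> = ennreal (c ^ DIM('a)) * (\<integral>\<^sup>+ x. g (c *\<^sub>R x) \<partial>lborel)"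
    using \<open>c > 0\<close> by (simp add: nn_integral_density nn_integral_distr nn_integral_cmult)
  finally show ?thesis .
qed

lemma sets_sphere_surface [simp, measurable_cong]: "sets sphere_surface = sets borel"
  by (simp add: sphere_surface_def)

lemma space_sphere_surface [simp]: "space sphere_surface = UNIV"
  using sets_eq_imp_space_eq[OF sets_sphere_surface] by simp

text \<open>The deleted origin is a null point at which \<open>sgn\<close> is 0; without it the set
  on the right is a truncated cone, on which dilations act cleanly.\<close>

lemma emeasure_sphere_surface:
  assumes [measurable]: "B \<in> sets borel"
  shows "emeasure (sphere_surface :: 'a::euclidean_space measure) B
    = of_nat DIM('a) * emeasure lborel {x. 0 < norm x \<and> norm x \<le> 1 \<and> sgn x \<in> (B :: 'a set)}"
proof -
  have "emeasure lborel {x. norm x \<le> 1 \<and> sgn x \<in> B}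
      = emeasure lborel {x. 0 < norm x \<and> norm x \<le> 1 \<and> sgn x \<in> B}"
  proof (rule emeasure_eq_AE)
    show "AE x in lborel. x \<in> {x. norm x \<le> 1 \<and> sgn x \<in> B}
        \<longleftrightarrow> x \<in> {x. 0 < norm x \<and> norm x \<le> 1 \<and> sgn x \<in> B}"
      using AE_lborel_singleton[of "0::'a"] by eventually_elim auto
  qed measurable
  moreover have "sgn -` B \<inter> cball 0 1 = {x. norm x \<le> 1 \<and> sgn x \<in> B}"
    by auto
  moreover have "sgn \<in> measurable (restrict_space lborel (cball (0::'a) 1)) borel"
    by (intro measurable_restrict_space1) measurable
  ultimately show ?thesis
    by (simp only: sphere_surface_def emeasure_scale_measure emeasure_distr assms
      space_restrict_space space_lborel Int_UNIV_right)
      (subst emeasure_restrict_space; auto)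
qed

lemma finite_measure_sphere_surface: "finite_measure (sphere_surface :: 'a::euclidean_space measure)"
proof
  have "emeasure lborel {x. 0 < norm x \<and> norm x \<le> 1 \<and> sgn x \<in> (UNIV :: 'a set)}
      \<le> emeasure lborel (cball (0::'a) 1)"
    by (intro emeasure_mono) auto
  also have "\<dots> < \<infinity>"
    using emeasure_lborel_cball_finite[of "0::'a" 1] by (simp add: less_top)
  finally show "emeasure sphere_surface (space (sphere_surface :: 'a measure)) \<noteq> \<infinity>"
    by (simp add: emeasure_sphere_surface ennreal_mult_eq_top_iff)
qed

text \<open>Dilation by \<open>\<rho>\<close> multiplies Lebesgue measure by
  \<open>\<rho> ^ DIM('a)\<close>, and the dimension factor of the surface measure is divided out.
  With \<open>d\<close> the dimension, \<open>\<rho> ^ d / d\<close> is the integral of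
  \<open>r ^ (d - 1)\<close> up to \<open>\<rho>\<close>, so it can be read as a radial
  mass.\<close>

lemma emeasure_cone_cball:
  assumes [measurable]: "B \<in> sets borel" and "\<rho> > 0"
  shows "emeasure lborel {x::'a::euclidean_space. 0 < norm x \<and> norm x \<le> \<rho> \<and> sgn x \<in> B}
    = ennreal (\<rho> ^ DIM('a) / DIM('a)) * emeasure sphere_surface B"
proof -
  let ?S = "\<lambda>\<rho>. {x::'a. 0 < norm x \<and> norm x \<le> \<rho> \<and> sgn x \<in> B}"
  have "emeasure lborel (?S \<rho>) = (\<integral>\<^sup>+ x. indicator (?S \<rho>) x \<partial>lborel)"
    by simp
  also have "\<dots> = ennreal (\<rho> ^ DIM('a)) * (\<integral>\<^sup>+ x. indicator (?S \<rho>) (\<rho> *\<^sub>R x) \<partial>lborel)"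
    using \<open>\<rho> > 0\<close> by (intro nn_integral_lborel_scale) auto
  also have "(\<lambda>x. indicator (?S \<rho>) (\<rho> *\<^sub>R x) :: ennreal) = indicator (?S 1)"
    using \<open>\<rho> > 0\<close> by (auto simp: fun_eq_iff indicator_def sgn_scaleR zero_less_mult_iff)
  finally have "emeasure lborel (?S \<rho>) = ennreal (\<rho> ^ DIM('a)) * emeasure lborel (?S 1)"
    by simp
  also have "ennreal (\<rho> ^ DIM('a)) = ennreal (\<rho> ^ DIM('a) / DIM('a)) * of_nat DIM('a)"
    using \<open>\<rho> > 0\<close> by (simp add: ennreal_of_nat_eq_real_of_nat flip: ennreal_mult'')
  finally show ?thesis
    by (simp add: emeasure_sphere_surface mult.assoc)
qed

lemma nn_integral_power_Ioc:
  assumes "\<rho> > 0" "d > 0"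
  shows "(\<integral>\<^sup>+ r. ennreal (r ^ (d - 1)) * indicator {0<..\<rho>} r \<partial>lborel) = ennreal (\<rho> ^ d / real d)"
proof -
  have "(\<integral>\<^sup>+ r. ennreal (r ^ (d - 1)) * indicator {0<..\<rho>} r \<partial>lborel)
      = (\<integral>\<^sup>+ r. ennreal (r ^ (d - 1)) * indicator {0..\<rho>} r \<partial>lborel)"
    using AE_lborel_singleton[of "0::real"]
    by (intro nn_integral_cong_AE) (auto elim!: eventually_mono simp: indicator_def)
  also have "\<dots> = ennreal (\<rho> ^ d / real d - 0 ^ d / real d)"
    using assms by (intro nn_integral_FTC_Icc[where F = "\<lambda>r. r ^ d / real d"])
      (auto intro!: derivative_eq_intros)
  finally show ?thesis using assms by (simp add: zero_power)
qed

definition radial_volume :: "nat \<Rightarrow> real measure" where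
  "radial_volume d = density lborel (\<lambda>r. ennreal (r ^ (d - 1)) * indicator {0<..} r)"

lemma sets_radial_volume [simp, measurable_cong]: "sets (radial_volume d) = sets borel"
  by (simp add: radial_volume_def)

lemma sigma_finite_radial_volume: "sigma_finite_measure (radial_volume d)"
  unfolding radial_volume_def
  by (subst sigma_finite_measure.sigma_finite_iff_density_finite[OF lborel.sigma_finite_measure_axioms])
    (auto simp: indicator_def)

lemma emeasure_radial_volume_atMost:
  assumes "d > 0"
  shows "emeasure (radial_volume d) {..\<rho>} = (if \<rho> > 0 then ennreal (\<rho> ^ d / real d) else 0)"
proof -
  have "emeasure (radial_volume d) {..\<rho>} = (\<integral>\<^sup>+ r. ennreal (r ^ (d - 1)) * indicator {0<..\<rho>} r \<partial>lborel)"
    unfolding radial_volume_def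
    by (subst emeasure_density) (auto intro!: nn_integral_cong simp: indicator_def)
  moreover have "{0<..\<rho>} = {}" if "\<not> \<rho> > 0"
    using that by auto
  ultimately show ?thesis
    using assms nn_integral_power_Ioc[of \<rho> d] by auto
qed

text \<open>For fixed \<open>B\<close> both sides are measures in \<open>A\<close>. The half-lines
  \<open>{..\<rho>}\<close> are closed under intersection, generate the Borel sets and have finite
  mass, and on them the claim is the truncated-cone formula
  \<open>emeasure_cone_cball\<close>.\<close>

lemma emeasure_radial_angular:
  fixes B :: "'a::euclidean_space set"
  assumes [measurable]: "A \<in> sets borel" "B \<in> sets borel"
  shows "emeasure lborel {x. x \<noteq> 0 \<and> norm x \<in> A \<and> sgn x \<in> B}
    = emeasure (radial_volume DIM('a)) A * emeasure sphere_surface B"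
proof -
  interpret finite_measure "sphere_surface :: 'a measure" by (rule finite_measure_sphere_surface)
  let ?N = "distr (density lborel (indicator {x. x \<noteq> 0 \<and> sgn x \<in> B})) borel norm"
  let ?R = "scale_measure (emeasure sphere_surface B) (radial_volume DIM('a))"
  have N: "emeasure ?N A = emeasure lborel {x. x \<noteq> 0 \<and> norm x \<in> A \<and> sgn x \<in> B}"
    if [measurable]: "A \<in> sets borel" for A
  proof -
    have "norm -` A \<in> sets (borel :: 'a measure)"
      using measurable_sets[of norm "borel :: 'a measure" borel A] that by simp
    then show ?thesis
      by (auto simp: emeasure_distr emeasure_restricted intro!: arg_cong[where f = "emeasure lborel"])
  qed
  have "?N = ?R"
  proof (rule measure_eqI_generator_eq[where E = "range atMost" and \<Omega> = UNIV and A = "\<lambda>i. {..real i}"])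
    show "Int_stable (range (atMost :: real \<Rightarrow> _))"
      by (auto simp: Int_stable_def)
    show "sets ?N = sigma_sets UNIV (range atMost)" "sets ?R = sigma_sets UNIV (range atMost)"
      by (simp_all add: borel_eq_atMost)
    show "(\<Union>i. {..real i}) = UNIV"
      by (auto intro: real_arch_simple)
    have eq: "emeasure ?N {..\<rho>} = emeasure ?R {..\<rho>}" for \<rho>
    proof (cases "\<rho> > 0")
      case True
      have "emeasure ?N {..\<rho>} = emeasure lborel {x. 0 < norm x \<and> norm x \<le> \<rho> \<and> sgn x \<in> B}"
        by (subst N) auto
      then show ?thesis
        using True emeasure_cone_cball[OF assms(2) True]
        by (simp add: emeasure_radial_volume_atMost mult.commute)
    next
      case False
      then have *: "{x. x \<noteq> 0 \<and> norm x \<in> {..\<rho>} \<and> sgn x \<in> B} = {}"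
        by auto (metis norm_le_zero_iff order_trans not_less)
      have "emeasure ?N {..\<rho>} = 0" unfolding N[OF atMost_borel] * by simp
      then show ?thesis
        using False by (simp add: emeasure_radial_volume_atMost)
    qed
    show "emeasure ?N X = emeasure ?R X" if "X \<in> range atMost" for X
      using that eq by auto
    show "emeasure ?N {..real i} \<noteq> \<infinity>" for i
      unfolding eq by (simp add: emeasure_radial_volume_atMost ennreal_mult_eq_top_iff)
  qed auto
  then show ?thesis using N[of A] by (simp add: mult.commute)
qed

text \<open>The factorisation on rectangles identifies the image of Lebesgue measure under the map
  to \<open>(norm x, sgn x)\<close> as a product measure, and
  \<open>norm x *\<^sub>R sgn x = x\<close> recovers the integrand from the two coordinates.\<close>

lemma nn_integral_polar:
  fixes g :: "'a::euclidean_space \<Rightarrow> ennreal"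
  assumes [measurable]: "g \<in> borel_measurable borel"
  shows "(\<integral>\<^sup>+ x. g x \<partial>lborel) = (\<integral>\<^sup>+ r. \<integral>\<^sup>+ \<phi>. ennreal (r ^ (DIM('a) - 1)) * indicator {0<..} r * g (r *\<^sub>R \<phi>)
    \<partial>sphere_surface \<partial>lborel)"
proof -
  interpret S: finite_measure "sphere_surface :: 'a measure" by (rule finite_measure_sphere_surface)
  let ?N = "distr (density lborel (indicator {x. x \<noteq> 0})) (borel \<Otimes>\<^sub>M borel) (\<lambda>x::'a. (norm x, sgn x))"
  have eq: "radial_volume DIM('a) \<Otimes>\<^sub>M (sphere_surface :: 'a measure) = ?N"
  proof (rule pair_measure_eqI)
    show "sets (radial_volume DIM('a) \<Otimes>\<^sub>M (sphere_surface :: 'a measure)) = sets ?N"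
      by (simp cong: sets_pair_measure_cong)
    fix A and B :: "'a set" assume "A \<in> sets (radial_volume DIM('a))" "B \<in> sets sphere_surface"
    then have [measurable]: "A \<in> sets borel" "B \<in> sets borel" by auto
    have "emeasure ?N (A \<times> B) = emeasure lborel {x. x \<noteq> 0 \<and> norm x \<in> A \<and> sgn x \<in> B}"
    proof -
      have "(\<lambda>x. (norm x, sgn x)) -` (A \<times> B) \<in> sets (borel :: 'a measure)"
        using measurable_sets[of "\<lambda>x::'a. (norm x, sgn x)" borel "borel \<Otimes>\<^sub>M borel" "A \<times> B"] by simp
      then show ?thesis
        by (auto simp: emeasure_distr emeasure_restricted intro!: arg_cong[where f = "emeasure lborel"])
    qed
    then show "emeasure (radial_volume DIM('a)) A * emeasure sphere_surface B = emeasure ?N (A \<times> B)"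
      by (simp add: emeasure_radial_angular)
  qed (simp_all add: sigma_finite_radial_volume S.sigma_finite_measure_axioms)
  have "(\<integral>\<^sup>+ x. g x \<partial>lborel) = (\<integral>\<^sup>+ x. indicator {x. x \<noteq> 0} x * g (norm x *\<^sub>R sgn x) \<partial>lborel)"
    using AE_lborel_singleton[of "0::'a"]
    by (intro nn_integral_cong_AE) (auto elim!: eventually_mono simp: sgn_div_norm)
  also have "\<dots> = (\<integral>\<^sup>+ z. g (fst z *\<^sub>R snd z) \<partial>?N)"
    by (simp add: nn_integral_distr nn_integral_density)
  also have "\<dots> = (\<integral>\<^sup>+ z. g (fst z *\<^sub>R snd z) \<partial>(radial_volume DIM('a) \<Otimes>\<^sub>M (sphere_surface :: 'a measure)))"
    by (simp add: eq)
  also have "\<dots> = (\<integral>\<^sup>+ r. \<integral>\<^sup>+ \<phi>. g (r *\<^sub>R \<phi>) \<partial>sphere_surface \<partial>radial_volume DIM('a))"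
    by (subst S.nn_integral_fst[symmetric]) auto
  also have "\<dots> = (\<integral>\<^sup>+ r. \<integral>\<^sup>+ \<phi>. ennreal (r ^ (DIM('a) - 1)) * indicator {0<..} r * g (r *\<^sub>R \<phi>)
    \<partial>sphere_surface \<partial>lborel)"
    unfolding radial_volume_def
    by (subst nn_integral_density) (auto simp: nn_integral_cmult)
  finally show ?thesis .
qed

subsection \<open>Pareto weights\<close>

text \<open>Deliberately of total mass \<open>1 / s\<close> instead of 1: without the factor
  \<open>s\<close> of the Pareto density, two weights with the same endpoint are pointwise ordered,
  and their L1 distance is a difference of masses.\<close>

definition pareto_weight :: "real \<Rightarrow> real \<Rightarrow> real \<Rightarrow> real" where
  "pareto_weight v s r = v powr s * r powr (- (s + 1)) * indicator {v<..} r"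

lemma pareto_weight_measurable [measurable]: "pareto_weight v s \<in> borel_measurable borel"
  unfolding pareto_weight_def[abs_def] by measurable

lemma pareto_weight_nonneg [simp]: "0 \<le> pareto_weight v s r"
  by (simp add: pareto_weight_def)

lemma has_integral_pareto_weight:
  assumes "v > 0" "s > 0"
  shows "has_bochner_integral lborel (pareto_weight v s) (1 / s)"
proof (rule has_bochner_integral_nn_integral)
  let ?F = "\<lambda>r. - (v powr s * r powr (- s) / s)"
  have "(\<integral>\<^sup>+ r. ennreal (pareto_weight v s r) \<partial>lborel)
      = (\<integral>\<^sup>+ r. ennreal (v powr s * r powr (- (s + 1))) * indicator {v..} r \<partial>lborel)"
    using AE_lborel_singleton[of v]
    by (intro nn_integral_cong_AE) (auto elim!: eventually_mono simp: pareto_weight_def indicator_def)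
  also have "\<dots> = ennreal (0 - ?F v)"
  proof (rule nn_integral_FTC_atLeast[where F = ?F])
    fix r assume "v \<le> r"
    then have "r > 0" using assms by simp
    then have "((\<lambda>r. r powr (- s)) has_real_derivative - s * r powr (- s - 1)) (at r)"
      by (rule has_real_derivative_powr)
    from DERIV_cmult[OF this, of "- (v powr s / s)"] assms
    show "(?F has_real_derivative v powr s * r powr (- (s + 1))) (at r)"
      by (simp add: minus_add_distrib[of s 1])
  next
    have "((\<lambda>r. r powr (- s)) \<longlongrightarrow> 0) at_top"
      using assms by (intro tendsto_neg_powr filterlim_ident) auto
    from tendsto_mult_left[OF this, of "- (v powr s / s)"] show "(?F \<longlongrightarrow> 0) at_top"
      by simp
  qed auto
  also have "0 - ?F v = 1 / s"
    using assms by (simp add: powr_minus field_simps)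
  finally show "(\<integral>\<^sup>+ r. ennreal (pareto_weight v s r) \<partial>lborel) = ennreal (1 / s)" .
qed (use assms in auto)

text \<open>Two Pareto weights with the same left endpoint \<open>v\<close> satisfy
  \<open>r * w r = (r / v) powr (- s)\<close>, so their difference has a constant sign.\<close>

lemma integral_pareto_weight_diff:
  assumes "v > 0" "s > 0" "s' > 0"
  shows "integral\<^sup>L lborel (\<lambda>r. \<bar>pareto_weight v s r - pareto_weight v s' r\<bar>) = \<bar>1 / s - 1 / s'\<bar>"
  using assms
proof (induction s s' rule: linorder_wlog)
  case (le s s')
  have w: "pareto_weight v \<tau> r = (v / r) powr \<tau> / r * indicator {v<..} r" for \<tau> r
  proof (cases "r > v")
    case True
    then have "r > 0" using le by simp
    moreover have "r powr (- (\<tau> + 1)) = 1 / (r powr \<tau> * r)"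
      using \<open>r > 0\<close> by (simp only: powr_minus powr_add powr_one inverse_eq_divide)
    ultimately show ?thesis
      using le by (simp add: pareto_weight_def powr_divide)
  qed (simp add: pareto_weight_def)
  have "pareto_weight v s' r \<le> pareto_weight v s r" for r
    unfolding w using le by (auto simp: indicator_def intro!: divide_right_mono powr_mono')
  then have "\<bar>pareto_weight v s r - pareto_weight v s' r\<bar> = pareto_weight v s r - pareto_weight v s' r" for r
    by simp
  moreover have "1 / s' \<le> 1 / s"
    using le by (simp add: frac_le)
  ultimately show ?case
    using le has_bochner_integral_integral_eq[OF has_bochner_integral_diff[OF
      has_integral_pareto_weight[of v s] has_integral_pareto_weight[of v s']]] by simp
next
  case (sym s s')
  then show ?case by (simp add: abs_minus_commute)
qed

text \<open>With \<open>w\<close> for the weights, the difference splits as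
  \<open>w s * (a - b) + (w s - w s') * b\<close>: the first part costs \<open>\<epsilon>\<close>
  times the mass \<open>1 / s\<close>, the second the bound \<open>c\<close> times the L1 distance
  of the weights. The function \<open>a\<close> is controlled only above \<open>v\<close>, where the
  weight lives, so its weighted integrability is deduced from that of \<open>a - b\<close> and
  \<open>b\<close>.\<close>

lemma pareto_integral_compare:
  assumes "v > 0" "s > 0" "s' > 0"
    and [measurable]: "a \<in> borel_measurable borel" "b \<in> borel_measurable borel"
    and b: "\<And>r. 0 \<le> b r" "\<And>r. b r \<le> c"
    and close: "\<And>r. v < r \<Longrightarrow> \<bar>a r - b r\<bar> \<le> \<epsilon>"
  shows "integrable lborel (\<lambda>r. pareto_weight v s r * a r)"
    and "\<bar>(\<integral>r. pareto_weight v s r * a r \<partial>lborel) - (\<integral>r. pareto_weight v s' r * b r \<partial>lborel)\<bar>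
      \<le> \<epsilon> / s + c * \<bar>1 / s - 1 / s'\<bar>"
proof -
  have int: "integrable lborel (pareto_weight v \<tau>)"
    and val: "integral\<^sup>L lborel (pareto_weight v \<tau>) = 1 / \<tau>" if "\<tau> > 0" for \<tau>
    using has_integral_pareto_weight[OF \<open>v > 0\<close> that] by (auto simp: has_bochner_integral_iff)
  let ?w = "pareto_weight v"
  have [measurable]: "?w s \<in> borel_measurable lborel" "?w s' \<in> borel_measurable lborel" by simp_all
  have "\<epsilon> \<ge> 0" using close[of "v + 1"] by auto
  have "c \<ge> 0" using b[of 0] by simp
  have wb: "integrable lborel (\<lambda>r. ?w \<tau> r * b r)" if "\<tau> > 0" for \<tau>
  proof (rule Bochner_Integration.integrable_bound)
    show "integrable lborel (\<lambda>r. ?w \<tau> r * c)"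
      using int[OF that] by (rule integrable_mult_left)
    show "AE r in lborel. norm (?w \<tau> r * b r) \<le> norm (?w \<tau> r * c)"
    proof (rule AE_I2)
      show "norm (?w \<tau> r * b r) \<le> norm (?w \<tau> r * c)" for r
        using b[of r] \<open>c \<ge> 0\<close> by (simp add: abs_mult mult_left_mono)
    qed
  qed simp
  have wd: "\<bar>?w s r * (a r - b r)\<bar> \<le> ?w s r * \<epsilon>" for r
    using close[of r] by (auto simp: pareto_weight_def abs_mult indicator_def intro!: mult_left_mono)
  have wab: "integrable lborel (\<lambda>r. ?w s r * (a r - b r))"
  proof (rule Bochner_Integration.integrable_bound)
    show "integrable lborel (\<lambda>r. ?w s r * \<epsilon>)"
      using int[OF \<open>s > 0\<close>] by (rule integrable_mult_left)
    show "AE r in lborel. norm (?w s r * (a r - b r)) \<le> norm (?w s r * \<epsilon>)"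
    proof (rule AE_I2)
      show "norm (?w s r * (a r - b r)) \<le> norm (?w s r * \<epsilon>)" for r
        using wd[of r] by simp
    qed
  qed simp
  from Bochner_Integration.integrable_add[OF wab wb[OF \<open>s > 0\<close>]]
  show wa: "integrable lborel (\<lambda>r. ?w s r * a r)"
    by (simp add: right_diff_distrib)
  have wd': "integrable lborel (\<lambda>r. (?w s r - ?w s' r))"
    by (intro Bochner_Integration.integrable_diff int assms)
  have eq: "(\<integral>r. ?w s r * a r \<partial>lborel) - (\<integral>r. ?w s' r * b r \<partial>lborel)
      = (\<integral>r. ?w s r * (a r - b r) + (?w s r - ?w s' r) * b r \<partial>lborel)"
    unfolding Bochner_Integration.integral_diff[OF wa wb[OF \<open>s' > 0\<close>], symmetric]
    by (intro Bochner_Integration.integral_cong refl) (simp add: algebra_simps)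
  have "\<bar>(\<integral>r. ?w s r * a r \<partial>lborel) - (\<integral>r. ?w s' r * b r \<partial>lborel)\<bar>
      \<le> (\<integral>r. \<bar>?w s r * (a r - b r) + (?w s r - ?w s' r) * b r\<bar> \<partial>lborel)"
    unfolding eq by (rule integral_abs_bound)
  also have "\<dots> \<le> (\<integral>r. ?w s r * \<epsilon> + \<bar>?w s r - ?w s' r\<bar> * c \<partial>lborel)"
  proof (rule integral_mono)
    have "integrable lborel (\<lambda>r. (?w s r - ?w s' r) * b r)"
      using Bochner_Integration.integrable_diff[OF wb[OF assms(2)] wb[OF assms(3)]]
      by (simp only: left_diff_distrib)
    with wab show "integrable lborel (\<lambda>r. \<bar>?w s r * (a r - b r) + (?w s r - ?w s' r) * b r\<bar>)"
      by (intro integrable_abs Bochner_Integration.integrable_add)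
    show "integrable lborel (\<lambda>r. ?w s r * \<epsilon> + \<bar>?w s r - ?w s' r\<bar> * c)"
      by (intro Bochner_Integration.integrable_add integrable_mult_left integrable_abs wd' int assms)
    fix r
    have "\<bar>(?w s r - ?w s' r) * b r\<bar> \<le> \<bar>?w s r - ?w s' r\<bar> * c"
      using b[of r] by (simp add: abs_mult mult_left_mono)
    with wd[of r] show "\<bar>?w s r * (a r - b r) + (?w s r - ?w s' r) * b r\<bar> \<le> ?w s r * \<epsilon> + \<bar>?w s r - ?w s' r\<bar> * c"
      by linarith
  qed
  also have "\<dots> = (\<integral>r. ?w s r * \<epsilon> \<partial>lborel) + (\<integral>r. \<bar>?w s r - ?w s' r\<bar> * c \<partial>lborel)"
    by (intro Bochner_Integration.integral_add integrable_mult_left integrable_abs wd' int assms)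
  also have "\<dots> = \<epsilon> / s + c * \<bar>1 / s - 1 / s'\<bar>"
    unfolding integral_mult_left_zero using assms(1-3)
    by (simp add: val integral_pareto_weight_diff)
  finally show "\<bar>(\<integral>r. ?w s r * a r \<partial>lborel) - (\<integral>r. ?w s' r * b r \<partial>lborel)\<bar>
      \<le> \<epsilon> / s + c * \<bar>1 / s - 1 / s'\<bar>" .
qed

subsection \<open>Angular structure of a regularly varying density\<close>

lemma sets_surface_measure [simp, measurable_cong]: "sets (surface_measure E) = sets borel"
  by (simp add: surface_measure_def)

lemma space_surface_measure [simp]: "space (surface_measure E) = UNIV"
  by (simp add: surface_measure_def)

lemma unit_directions_borel [measurable]:
  assumes "closed E"
  shows "unit_directions E \<in> sets borel"
proof -
  have "unit_directions E = E \<inter> sphere 0 1"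
    by (auto simp: unit_directions_def)
  then show ?thesis using assms by auto
qed

lemma AE_sphere_surface: "AE \<phi> in sphere_surface. norm \<phi> = 1"
proof -
  let ?B = "{\<phi>. norm \<phi> \<noteq> 1} :: 'a set"
  have "{x. 0 < norm x \<and> norm x \<le> 1 \<and> sgn x \<in> ?B} = {}"
    by (auto simp: norm_sgn)
  moreover have "?B \<in> sets borel" by simp
  ultimately have "emeasure sphere_surface ?B = 0"
    unfolding emeasure_sphere_surface[OF \<open>?B \<in> sets borel\<close>] by (simp only: emeasure_empty mult_zero_right)
  then show ?thesis by (intro AE_I[of _ _ ?B]) auto
qed

lemma finite_measure_surface_measure:
  assumes "closed E"
  shows "finite_measure (surface_measure E)"
  unfolding surface_measure_def
  by (intro finite_measure.finite_measure_restricted[OF finite_measure_sphere_surface])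
    (use assms in auto)

lemma nn_integral_surface_measure:
  fixes g :: "'a::euclidean_space \<Rightarrow> ennreal"
  assumes "closed E" and [measurable]: "g \<in> borel_measurable borel"
  shows "(\<integral>\<^sup>+ \<phi>. g \<phi> \<partial>surface_measure E) = (\<integral>\<^sup>+ \<phi>. indicator (unit_directions E) \<phi> * g \<phi> \<partial>sphere_surface)"
  unfolding surface_measure_def using assms(1)
  by (subst nn_integral_density) auto

text \<open>Tonelli's theorem, arranged so that for each \<open>r\<close> the angular integral is
  the mass of one section of \<open>A\<close>. \<open>emeasure_P_polar\<close> puts \<open>P\<close>
  in the same shape, so the two laws can be compared radius by radius.\<close>

lemma emeasure_polar_tail_measure:
  fixes \<psi> :: "'a::euclidean_space \<Rightarrow> real"
  assumes "closed E" "0 \<le> p" "0 \<le> s"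
    and [measurable]: "\<psi> \<in> borel_measurable borel" "A \<in> sets borel"
  shows "emeasure (polar_tail_measure E t p s \<psi>) A
    = (\<integral>\<^sup>+ r. ennreal (p * s * pareto_weight t s r)
        * emeasure (density (surface_measure E) \<psi>) {\<phi>. r *\<^sub>R \<phi> \<in> A} \<partial>lborel)"
proof -
  interpret S: finite_measure "surface_measure E"
    by (rule finite_measure_surface_measure) fact
  let ?d = "\<lambda>(r, \<phi>). ennreal (p * s * t powr s * r powr (- (s + 1)) * \<psi> \<phi>) * indicator {t<..} r"
  have [measurable]: "{\<phi>. r *\<^sub>R \<phi> \<in> A} \<in> sets borel" for r
    by measurable
  have "emeasure (polar_tail_measure E t p s \<psi>) A
      = (\<integral>\<^sup>+ z. ?d z * indicator {z. fst z *\<^sub>R snd z \<in> A} z \<partial>(lborel \<Otimes>\<^sub>M surface_measure E))"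
    using measurable_sets[of "\<lambda>z. fst z *\<^sub>R snd z" "lborel \<Otimes>\<^sub>M surface_measure E" borel A]
    unfolding polar_tail_measure_def
    by (subst emeasure_distr) (auto simp: emeasure_density space_pair_measure split_beta' vimage_def)
  also have "\<dots> = (\<integral>\<^sup>+ r. \<integral>\<^sup>+ \<phi>. ennreal (p * s * pareto_weight t s r)
      * (ennreal (\<psi> \<phi>) * indicator {\<phi>. r *\<^sub>R \<phi> \<in> A} \<phi>) \<partial>surface_measure E \<partial>lborel)"
    by (subst S.nn_integral_fst[symmetric])
      (auto simp: pareto_weight_def indicator_def mult.assoc ennreal_mult' assms intro!: nn_integral_cong)
  also have "\<dots> = (\<integral>\<^sup>+ r. ennreal (p * s * pareto_weight t s r)
        * emeasure (density (surface_measure E) \<psi>) {\<phi>. r *\<^sub>R \<phi> \<in> A} \<partial>lborel)"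
    by (intro nn_integral_cong) (simp add: nn_integral_cmult emeasure_density)
  finally show ?thesis .
qed

section \<open>The law \<open>P\<close> in polar coordinates and its limiting angular
  measure\<close>

locale regularly_varying_model =
  fixes E :: "'a::euclidean_space set" and P :: "'a measure"
    and f phi_star :: "'a \<Rightarrow> real" and s \<gamma> :: real
  assumes closed_E: "closed E" and cone_E: "cone E"
    and density: "supported_density E f" "P = density lborel f"
    and regular_variation: "density_regularly_varying E f s phi_star"
    and second_order: "second_order_condition E f s phi_star \<gamma>"
begin

lemma f_measurable [measurable]: "f \<in> borel_measurable borel"
  and f_nonneg: "0 \<le> f x"
  and f_outside: "x \<notin> E \<Longrightarrow> f x = 0"
  and prob_space_P: "prob_space P"
  using density by (auto simp: supported_density_def)

lemma s_pos: "0 < s" and \<gamma>_pos: "0 < \<gamma>"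
  using regular_variation second_order
  by (auto simp: density_regularly_varying_def second_order_condition_def)

lemma sets_P [simp, measurable_cong]: "sets P = sets borel"
  by (simp add: density)

lemma space_P [simp]: "space P = UNIV"
  by (simp add: density)

lemma E_borel [measurable]: "E \<in> sets borel" "unit_directions E \<in> sets borel"
  using closed_E by auto

lemma scaleR_in_E: "x \<in> E \<Longrightarrow> 0 \<le> c \<Longrightarrow> c *\<^sub>R x \<in> E"
  using cone_E by (auto simp: cone_def)

lemma scaleR_in_E_iff: "0 < c \<Longrightarrow> c *\<^sub>R x \<in> E \<longleftrightarrow> x \<in> E"
  using scaleR_in_E[of x c] scaleR_in_E[of "c *\<^sub>R x" "inverse c"] by auto

abbreviation "\<sigma> \<equiv> surface_measure E"

sublocale S: finite_measure \<sigma>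
  by (rule finite_measure_surface_measure[OF closed_E])

definition limit_density :: "'a \<Rightarrow> real" where
  "limit_density \<phi> = (if \<phi> \<in> unit_directions E then phi_star \<phi> else 0)"

definition scaled_density :: "real \<Rightarrow> 'a \<Rightarrow> real" where
  "scaled_density r \<phi> = r powr (s + real DIM('a)) * f (r *\<^sub>R \<phi>)"

lemma scaled_density_measurable [measurable]: "case_prod scaled_density \<in> borel_measurable (borel \<Otimes>\<^sub>M borel)"
  unfolding scaled_density_def by measurable

lemma scaled_density_measurable' [measurable]: "scaled_density r \<in> borel_measurable borel"
  unfolding scaled_density_def[abs_def] by measurable

lemma scaled_density_nonneg: "0 \<le> scaled_density r \<phi>"
  by (simp add: scaled_density_def f_nonneg)

text \<open>With \<open>d\<close> the dimension, the Jacobian \<open>r ^ (d - 1)\<close> is split as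
  \<open>r powr (- (s + 1)) * r powr (s + d)\<close>, and \<open>v powr (- s)\<close> undoes the
  factor built into the weight; so \<open>v\<close> may be any positive radius beyond which
  \<open>A\<close> lies. Directions outside \<open>E\<close> contribute nothing, since
  \<open>E\<close> is a cone and \<open>f\<close> vanishes off it.\<close>

lemma emeasure_P_polar:
  assumes [measurable]: "A \<in> sets borel" and "A \<subseteq> {x. norm x > v}" "v > 0"
  shows "emeasure P A = (\<integral>\<^sup>+ r. ennreal (v powr (- s) * pareto_weight v s r)
    * emeasure (density \<sigma> (scaled_density r)) {\<phi>. r *\<^sub>R \<phi> \<in> A} \<partial>lborel)"
proof -
  have "emeasure P A = (\<integral>\<^sup>+ x. ennreal (f x) * indicator A x \<partial>lborel)"
    by (simp add: density emeasure_density)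
  also have "\<dots> = (\<integral>\<^sup>+ r. \<integral>\<^sup>+ \<phi>. ennreal (r ^ (DIM('a) - 1)) * indicator {0<..} r
      * (ennreal (f (r *\<^sub>R \<phi>)) * indicator A (r *\<^sub>R \<phi>)) \<partial>sphere_surface \<partial>lborel)"
    by (intro nn_integral_polar) simp
  also have "\<dots> = (\<integral>\<^sup>+ r. ennreal (v powr (- s) * pareto_weight v s r)
    * emeasure (density \<sigma> (scaled_density r)) {\<phi>. r *\<^sub>R \<phi> \<in> A} \<partial>lborel)"
  proof (intro nn_integral_cong)
    fix r :: real
    have [measurable]: "{\<phi>. r *\<^sub>R \<phi> \<in> A} \<in> sets borel"
      by measurable
    have "(\<integral>\<^sup>+ \<phi>. ennreal (r ^ (DIM('a) - 1)) * indicator {0<..} r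
        * (ennreal (f (r *\<^sub>R \<phi>)) * indicator A (r *\<^sub>R \<phi>)) \<partial>sphere_surface)
      = (\<integral>\<^sup>+ \<phi>. ennreal (v powr (- s) * pareto_weight v s r)
        * (indicator (unit_directions E) \<phi> * (ennreal (scaled_density r \<phi>) * indicator {\<phi>. r *\<^sub>R \<phi> \<in> A} \<phi>)) \<partial>sphere_surface)"
    proof (rule nn_integral_cong_AE, rule AE_mp[OF AE_sphere_surface AE_I2], intro impI)
      fix \<phi> :: 'a assume \<phi>: "norm \<phi> = 1"
      show "ennreal (r ^ (DIM('a) - 1)) * indicator {0<..} r * (ennreal (f (r *\<^sub>R \<phi>)) * indicator A (r *\<^sub>R \<phi>))
        = ennreal (v powr (- s) * pareto_weight v s r)
        * (indicator (unit_directions E) \<phi> * (ennreal (scaled_density r \<phi>) * indicator {\<phi>. r *\<^sub>R \<phi> \<in> A} \<phi>))"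
      proof (cases "r > v \<and> \<phi> \<in> E \<and> r *\<^sub>R \<phi> \<in> A")
        case True
        have "r powr (- (s + 1)) * r powr (s + real DIM('a)) = r powr real (DIM('a) - 1)"
          unfolding powr_add[symmetric] by (simp add: of_nat_diff Suc_leI)
        also have "\<dots> = r ^ (DIM('a) - 1)"
          using True \<open>v > 0\<close> by (subst powr_realpow) auto
        finally have "v powr (- s) * pareto_weight v s r * scaled_density r \<phi> = r ^ (DIM('a) - 1) * f (r *\<^sub>R \<phi>)"
          using True \<open>v > 0\<close>
          by (simp add: pareto_weight_def scaled_density_def powr_minus mult.assoc[symmetric])
        then show ?thesis
          using True \<phi> \<open>v > 0\<close> by (simp add: unit_directions_def f_nonneg scaled_density_nonneg flip: ennreal_mult)
      next
        case False
        have "r \<le> v \<Longrightarrow> r > 0 \<Longrightarrow> r *\<^sub>R \<phi> \<notin> A"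
          using assms(2) \<phi> by auto
        moreover have "r > 0 \<Longrightarrow> \<phi> \<notin> E \<Longrightarrow> f (r *\<^sub>R \<phi>) = 0"
          by (intro f_outside) (simp add: scaleR_in_E_iff)
        ultimately show ?thesis
          using False \<open>v > 0\<close> by (auto simp: pareto_weight_def indicator_def unit_directions_def)
      qed
    qed
    also have "\<dots> = ennreal (v powr (- s) * pareto_weight v s r)
        * emeasure (density \<sigma> (scaled_density r)) {\<phi>. r *\<^sub>R \<phi> \<in> A}"
      by (simp add: nn_integral_cmult emeasure_density nn_integral_surface_measure[OF closed_E])
    finally show "(\<integral>\<^sup>+ \<phi>. ennreal (r ^ (DIM('a) - 1)) * indicator {0<..} r
        * (ennreal (f (r *\<^sub>R \<phi>)) * indicator A (r *\<^sub>R \<phi>)) \<partial>sphere_surface)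
      = ennreal (v powr (- s) * pareto_weight v s r)
        * emeasure (density \<sigma> (scaled_density r)) {\<phi>. r *\<^sub>R \<phi> \<in> A}" .
  qed
  finally show ?thesis .
qed

lemma limit_density_nonneg: "0 \<le> limit_density \<phi>"
  and limit_density_pos: "\<phi> \<in> unit_directions E \<Longrightarrow> 0 < limit_density \<phi>"
proof -
  have "\<phi> \<in> unit_directions E \<Longrightarrow> 0 < phi_star \<phi>"
    using regular_variation by (auto simp: density_regularly_varying_def unit_directions_def)
  then show "0 \<le> limit_density \<phi>" "\<phi> \<in> unit_directions E \<Longrightarrow> 0 < limit_density \<phi>"
    by (auto simp: limit_density_def less_imp_le)
qed

lemma regular_variation_at:
  assumes "z \<in> E - {0}"
  shows "((\<lambda>t. t powr (s + real DIM('a)) * f (t *\<^sub>R z)) \<longlongrightarrow> phi_star z) at_top"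
proof -
  have "compact {z} \<and> {z} \<subseteq> E - {0}" using assms by simp
  then have "uniform_limit {z} (\<lambda>t z. t powr (s + real DIM('a)) * f (t *\<^sub>R z)) phi_star at_top"
    using regular_variation unfolding density_regularly_varying_def by blast
  then show ?thesis
    by (rule tendsto_uniform_limitI) simp
qed

text \<open>Measurability of \<open>phi_star\<close> is not given; on the unit directions it is
  inherited from the densities \<open>scaled_density (real n)\<close>, whose pointwise limit it is.
  The cut-off to 0 elsewhere removes the values that this limit does not reach.\<close>

lemma limit_density_measurable [measurable]: "limit_density \<in> borel_measurable borel"
proof (rule borel_measurable_LIMSEQ_real)
  show "(\<lambda>n. indicator (unit_directions E) \<phi> * scaled_density (real n) \<phi>) \<longlonglongrightarrow> limit_density \<phi>" for \<phi>
  proof (cases "\<phi> \<in> unit_directions E")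
    case True
    then have "\<phi> \<in> E - {0}" by (auto simp: unit_directions_def)
    from filterlim_compose[OF regular_variation_at[OF this] filterlim_real_sequentially] True
    show ?thesis by (simp add: limit_density_def scaled_density_def)
  qed (simp add: limit_density_def)
qed simp

lemma second_order_bounds:
  obtains C T where "C \<ge> 0" "T > 0"
    "\<And>v r \<phi>. T \<le> v \<Longrightarrow> v < r \<Longrightarrow> \<phi> \<in> unit_directions E
      \<Longrightarrow> \<bar>scaled_density r \<phi> - limit_density \<phi>\<bar> \<le> C * v powr (- \<gamma>)"
proof -
  from second_order obtain C T where *: "\<And>v r \<phi>. T \<le> v \<Longrightarrow> v < r \<Longrightarrow> \<phi> \<in> unit_directions E
      \<Longrightarrow> \<bar>r powr (s + real DIM('a)) * f (r *\<^sub>R \<phi>) - phi_star \<phi>\<bar> \<le> C * v powr (- \<gamma>)"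
    unfolding second_order_condition_def eventually_at_top_linorder by blast
  show thesis
  proof (rule that[of "max C 0" "max T 1"])
    fix v r :: real and \<phi>
    assume "max T 1 \<le> v" "v < r" "\<phi> \<in> unit_directions E"
    then have "\<bar>scaled_density r \<phi> - limit_density \<phi>\<bar> \<le> C * v powr (- \<gamma>)"
      using *[of v r \<phi>] by (simp add: scaled_density_def limit_density_def)
    also have "\<dots> \<le> max C 0 * v powr (- \<gamma>)"
      by (intro mult_right_mono) auto
    finally show "\<bar>scaled_density r \<phi> - limit_density \<phi>\<bar> \<le> max C 0 * v powr (- \<gamma>)" .
  qed auto
qed

text \<open>One radius suffices: on the compact set \<open>E \<inter> sphere 0 r\<close> the
  continuous \<open>f\<close> is bounded, and the second-order condition keeps
  \<open>limit_density\<close> within a constant of the rescaled \<open>f\<close> there. Adding 1 in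
  the choice of \<open>r\<close> puts it strictly beyond both \<open>r0\<close> and
  \<open>T\<close>.\<close>

lemma limit_density_bounded: obtains b where "\<And>\<phi>. limit_density \<phi> \<le> b" "b \<ge> 0"
proof -
  from regular_variation obtain r0 where r0: "r0 > 0" "continuous_on (E - cball 0 r0) f"
    by (auto simp: density_regularly_varying_def)
  obtain C T where CT: "C \<ge> 0" "T > 0" "\<And>v r \<phi>. T \<le> v \<Longrightarrow> v < r \<Longrightarrow> \<phi> \<in> unit_directions E
      \<Longrightarrow> \<bar>scaled_density r \<phi> - limit_density \<phi>\<bar> \<le> C * v powr (- \<gamma>)"
    using second_order_bounds by blast
  define r where "r = max r0 T + 1"
  have r: "r > r0" "r > T" "r > 0" using r0 by (auto simp: r_def)
  have "compact (E \<inter> sphere 0 r)"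
    by (intro closed_Int_compact closed_E) simp
  moreover have "continuous_on (E \<inter> sphere 0 r) f"
    using r by (intro continuous_on_subset[OF r0(2)]) auto
  ultimately have "bounded (f ` (E \<inter> sphere 0 r))"
    by (intro compact_imp_bounded compact_continuous_image)
  then obtain b where b: "b > 0" "\<And>x. x \<in> E \<inter> sphere 0 r \<Longrightarrow> \<bar>f x\<bar> \<le> b"
    by (auto simp: bounded_pos)
  show thesis
  proof (rule that)
    fix \<phi> show "limit_density \<phi> \<le> r powr (s + real DIM('a)) * b + C * T powr (- \<gamma>)"
    proof (cases "\<phi> \<in> unit_directions E")
      case True
      then have "r *\<^sub>R \<phi> \<in> E \<inter> sphere 0 r"
        using r by (auto simp: unit_directions_def scaleR_in_E)
      then have "scaled_density r \<phi> \<le> r powr (s + real DIM('a)) * b"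
        unfolding scaled_density_def using b(2)[of "r *\<^sub>R \<phi>"] by (intro mult_left_mono) auto
      with CT(3)[OF order_refl \<open>r > T\<close> True] show ?thesis by linarith
    qed (use b CT in \<open>simp add: limit_density_def\<close>)
  qed (use b CT in simp)
qed

definition limit_measure :: "'a measure" where
  "limit_measure = density \<sigma> limit_density"

lemma sets_limit_measure [simp, measurable_cong]: "sets limit_measure = sets borel"
  by (simp add: limit_measure_def)

lemma integrable_limit_density: "integrable \<sigma> limit_density"
proof -
  obtain b where "\<And>\<phi>. limit_density \<phi> \<le> b" "b \<ge> 0"
    using limit_density_bounded by blast
  then show ?thesis
    by (intro S.integrable_const_bound[of _ b]) (auto simp: limit_density_nonneg)
qed

lemma measure_density_surface:
  assumes "integrable \<sigma> h" "\<And>\<phi>. 0 \<le> h \<phi>" and [measurable]: "B \<in> sets borel"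
  shows "emeasure (density \<sigma> h) B = ennreal (\<integral>\<phi>. h \<phi> * indicator B \<phi> \<partial>\<sigma>)"
    and "measure (density \<sigma> h) B = (\<integral>\<phi>. h \<phi> * indicator B \<phi> \<partial>\<sigma>)"
proof -
  have [measurable]: "h \<in> borel_measurable borel"
    using borel_measurable_integrable[OF assms(1)] by simp
  have int: "integrable \<sigma> (\<lambda>\<phi>. h \<phi> * indicator B \<phi>)"
    using assms by (intro integrable_real_mult_indicator) auto
  have "emeasure (density \<sigma> h) B = (\<integral>\<^sup>+ \<phi>. ennreal (h \<phi> * indicator B \<phi>) \<partial>\<sigma>)"
    by (subst emeasure_density) (auto simp: ennreal_mult' assms ennreal_indicator intro!: nn_integral_cong)
  also have "\<dots> = ennreal (\<integral>\<phi>. h \<phi> * indicator B \<phi> \<partial>\<sigma>)"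
    using int assms by (intro nn_integral_eq_integral) auto
  finally show "emeasure (density \<sigma> h) B = ennreal (\<integral>\<phi>. h \<phi> * indicator B \<phi> \<partial>\<sigma>)" .
  then show "measure (density \<sigma> h) B = (\<integral>\<phi>. h \<phi> * indicator B \<phi> \<partial>\<sigma>)"
    using assms by (simp add: measure_def integral_nonneg)
qed

lemma finite_measure_limit_measure: "finite_measure limit_measure"
proof
  have "emeasure (density \<sigma> limit_density) UNIV \<noteq> \<infinity>"
    by (subst measure_density_surface(1)) (auto intro: integrable_limit_density limit_density_nonneg)
  then show "emeasure limit_measure (space limit_measure) \<noteq> \<infinity>"
    by (simp add: limit_measure_def)
qed

sublocale LM: finite_measure limit_measure
  by (rule finite_measure_limit_measure)

lemma AE_surface_measure: "AE \<phi> in \<sigma>. \<phi> \<in> unit_directions E"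
  unfolding surface_measure_def by (subst AE_density) (auto simp: indicator_def)

text \<open>Integrating the pointwise second-order error over the finite surface measure makes it
  uniform over Borel sets, which is the form comparable with total variation.\<close>

lemma scaled_density_limit:
  obtains C T where "C \<ge> 0" "T > 0"
    "\<And>v r B. T \<le> v \<Longrightarrow> v < r \<Longrightarrow> B \<in> sets borel
      \<Longrightarrow> \<bar>measure (density \<sigma> (scaled_density r)) B - measure limit_measure B\<bar> \<le> C * v powr (- \<gamma>)"
    "\<And>r. T < r \<Longrightarrow> finite_measure (density \<sigma> (scaled_density r))"
proof -
  obtain b where b: "\<And>\<phi>. limit_density \<phi> \<le> b" "b \<ge> 0"
    using limit_density_bounded by blast
  obtain C T where CT: "C \<ge> 0" "T > 0" "\<And>v r \<phi>. T \<le> v \<Longrightarrow> v < r \<Longrightarrow> \<phi> \<in> unit_directions E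
      \<Longrightarrow> \<bar>scaled_density r \<phi> - limit_density \<phi>\<bar> \<le> C * v powr (- \<gamma>)"
    using second_order_bounds by blast
  have int: "integrable \<sigma> (scaled_density r)" if "T < r" for r
  proof (rule S.integrable_const_bound)
    show "AE \<phi> in \<sigma>. norm (scaled_density r \<phi>) \<le> b + C * T powr (- \<gamma>)"
      using AE_surface_measure
    proof eventually_elim
      case (elim \<phi>)
      with CT(3)[of T r \<phi>] that b(1)[of \<phi>] scaled_density_nonneg[of r \<phi>] show ?case by simp
    qed
  qed simp
  show thesis
  proof (rule that)
    show "0 \<le> C * measure \<sigma> UNIV" "T > 0" using CT by auto
    show "finite_measure (density \<sigma> (scaled_density r))" if "T < r" for r
    proof
      show "emeasure (density \<sigma> (scaled_density r)) (space (density \<sigma> (scaled_density r))) \<noteq> \<infinity>"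
        using measure_density_surface(1)[OF int[OF that] scaled_density_nonneg, of UNIV] by simp
    qed
    fix v r :: real and B :: "'a set" assume vr: "T \<le> v" "v < r" and [measurable]: "B \<in> sets borel"
    have i: "integrable \<sigma> (\<lambda>\<phi>. scaled_density r \<phi> * indicator B \<phi>)"
      "integrable \<sigma> (\<lambda>\<phi>. limit_density \<phi> * indicator B \<phi>)"
      using vr int[of r] integrable_limit_density by (auto intro!: integrable_real_mult_indicator)
    have "measure (density \<sigma> (scaled_density r)) B - measure limit_measure B
        = (\<integral>\<phi>. scaled_density r \<phi> * indicator B \<phi> - limit_density \<phi> * indicator B \<phi> \<partial>\<sigma>)"
      using vr int[of r] i unfolding limit_measure_def
      by (simp add: measure_density_surface integrable_limit_density limit_density_nonneg scaled_density_nonneg)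
    then have "\<bar>measure (density \<sigma> (scaled_density r)) B - measure limit_measure B\<bar>
        \<le> (\<integral>\<phi>. \<bar>scaled_density r \<phi> * indicator B \<phi> - limit_density \<phi> * indicator B \<phi>\<bar> \<partial>\<sigma>)"
      by (metis integral_abs_bound)
    also have "\<dots> \<le> (\<integral>\<phi>. C * v powr (- \<gamma>) \<partial>\<sigma>)"
    proof (rule integral_mono_AE)
      show "integrable \<sigma> (\<lambda>\<phi>. \<bar>scaled_density r \<phi> * indicator B \<phi> - limit_density \<phi> * indicator B \<phi>\<bar>)"
        by (intro integrable_abs Bochner_Integration.integrable_diff i)
      show "AE \<phi> in \<sigma>. \<bar>scaled_density r \<phi> * indicator B \<phi> - limit_density \<phi> * indicator B \<phi>\<bar> \<le> C * v powr (- \<gamma>)"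
        using AE_surface_measure
      proof eventually_elim
        case (elim \<phi>)
        with CT(1) CT(3)[of v r \<phi>] vr show ?case by (auto simp: indicator_def)
      qed
    qed simp
    also have "\<dots> = C * measure \<sigma> UNIV * v powr (- \<gamma>)"
      by simp
    finally show "\<bar>measure (density \<sigma> (scaled_density r)) B - measure limit_measure B\<bar>
      \<le> C * measure \<sigma> UNIV * v powr (- \<gamma>)" .
  qed
qed

end

text \<open>Passage from \<open>ennreal\<close> to real integrals. Finiteness of \<open>e\<close> is
  asked only above \<open>v\<close>, as the weight vanishes elsewhere: at small radii, where
  \<open>f\<close> is not controlled, an angular section of \<open>P\<close> may have infinite
  mass.\<close>

lemma measure_eq_pareto_integral:
  assumes eq: "emeasure N A = (\<integral>\<^sup>+ r. ennreal (k * pareto_weight v s r) * e r \<partial>lborel)"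
    and [measurable]: "e \<in> borel_measurable borel" and fin: "\<And>r. v < r \<Longrightarrow> e r \<noteq> \<top>" and "0 \<le> k"
  shows "measure N A = k * (\<integral>r. pareto_weight v s r * enn2real (e r) \<partial>lborel)"
proof -
  have "emeasure N A = (\<integral>\<^sup>+ r. ennreal (k * (pareto_weight v s r * enn2real (e r))) \<partial>lborel)"
    unfolding eq
  proof (intro nn_integral_cong)
    fix r
    show "ennreal (k * pareto_weight v s r) * e r = ennreal (k * (pareto_weight v s r * enn2real (e r)))"
    proof (cases "v < r")
      case True
      then have "e r = ennreal (enn2real (e r))"
        using fin[of r] by (simp add: less_top)
      then show ?thesis
        using \<open>0 \<le> k\<close> by (metis ennreal_mult' mult.assoc mult_nonneg_nonneg pareto_weight_nonneg)
    qed (simp add: pareto_weight_def)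
  qed
  then have "measure N A = (\<integral>r. k * (pareto_weight v s r * enn2real (e r)) \<partial>lborel)"
    using \<open>0 \<le> k\<close> by (simp add: measure_def integral_eq_nn_integral del: integral_mult_right_zero)
  then show ?thesis by simp
qed

context regularly_varying_model
begin

lemma AE_density_surface_measure:
  assumes [measurable]: "h \<in> borel_measurable borel"
  shows "AE \<phi> in density \<sigma> h. \<phi> \<in> unit_directions E"
  using AE_surface_measure by (subst AE_density) (auto elim!: eventually_mono)

lemma measurable_section_density:
  assumes [measurable]: "case_prod h \<in> borel_measurable (borel \<Otimes>\<^sub>M borel)" "A \<in> sets borel"
  shows "(\<lambda>r. emeasure (density \<sigma> (h r)) {\<phi>. r *\<^sub>R \<phi> \<in> A}) \<in> borel_measurable borel"
proof -
  have [measurable]: "{\<phi>. r *\<^sub>R \<phi> \<in> A} \<in> sets borel" for r :: real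
    by measurable
  have [measurable]: "h r \<in> borel_measurable borel" for r
    by measurable
  have "(\<lambda>r. \<integral>\<^sup>+ \<phi>. h r \<phi> * indicator A (r *\<^sub>R \<phi>) \<partial>\<sigma>) \<in> borel_measurable borel"
    by measurable
  also have "(\<lambda>r. \<integral>\<^sup>+ \<phi>. h r \<phi> * indicator A (r *\<^sub>R \<phi>) \<partial>\<sigma>)
      = (\<lambda>r. emeasure (density \<sigma> (h r)) {\<phi>. r *\<^sub>R \<phi> \<in> A})"
    by (auto simp: emeasure_density fun_eq_iff indicator_def intro!: nn_integral_cong)
  finally show ?thesis .
qed

lemma measure_P_section:
  assumes [measurable]: "A \<in> sets borel" and "A \<subseteq> {x. norm x > v}" "v > 0"
    and fin: "\<And>r. v < r \<Longrightarrow> finite_measure (density \<sigma> (scaled_density r))"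
  shows "v powr s * measure P A
    = (\<integral>r. pareto_weight v s r * measure (density \<sigma> (scaled_density r)) {\<phi>. r *\<^sub>R \<phi> \<in> A} \<partial>lborel)"
proof -
  have "measure P A = v powr (- s) * (\<integral>r. pareto_weight v s r
      * enn2real (emeasure (density \<sigma> (scaled_density r)) {\<phi>. r *\<^sub>R \<phi> \<in> A}) \<partial>lborel)"
    using finite_measure.emeasure_finite[OF fin]
    by (intro measure_eq_pareto_integral emeasure_P_polar assms measurable_section_density) auto
  then show ?thesis
    using \<open>v > 0\<close> by (simp add: measure_def powr_minus)
qed

text \<open>Moving the endpoint from \<open>t\<close> to \<open>v\<close> only changes the constant,
  because the radial density is a pure power above \<open>t\<close>. Radii between \<open>t\<close>
  and \<open>v\<close> have positive weight for endpoint \<open>t\<close> but none for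
  \<open>v\<close>; they contribute nothing, since \<open>A\<close> lies beyond \<open>v\<close> and
  the angular measure lives on unit vectors.\<close>

lemma measure_ssgen_section:
  assumes gen: "ssgen_law E t p s' \<psi> Q" and "0 < p" "0 < s'" "0 < t" "t \<le> v"
    and [measurable]: "\<psi> \<in> borel_measurable borel" "A \<in> sets borel" and "A \<subseteq> {x. norm x > v}"
    and fin: "finite_measure (density \<sigma> \<psi>)"
  shows "v powr s' / (p * s' * t powr s') * measure Q A
    = (\<integral>r. pareto_weight v s' r * measure (density \<sigma> \<psi>) {\<phi>. r *\<^sub>R \<phi> \<in> A} \<partial>lborel)"
proof -
  let ?k = "p * s' * t powr s' * v powr (- s')"
  have [measurable]: "{\<phi>. r *\<^sub>R \<phi> \<in> A} \<in> sets borel" for r :: real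
    by measurable
  have "A \<subseteq> {x. norm x > t}" using assms by auto
  then have "emeasure Q A = (\<integral>\<^sup>+ r. ennreal (p * s' * pareto_weight t s' r)
      * emeasure (density \<sigma> \<psi>) {\<phi>. r *\<^sub>R \<phi> \<in> A} \<partial>lborel)"
    using gen assms closed_E by (simp add: ssgen_law_def emeasure_polar_tail_measure)
  also have "\<dots> = (\<integral>\<^sup>+ r. ennreal (?k * pareto_weight v s' r)
      * emeasure (density \<sigma> \<psi>) {\<phi>. r *\<^sub>R \<phi> \<in> A} \<partial>lborel)"
  proof (intro nn_integral_cong)
    fix r :: real
    consider "v < r" | "r \<le> t" | "t < r" "r \<le> v" by linarith
    then show "ennreal (p * s' * pareto_weight t s' r) * emeasure (density \<sigma> \<psi>) {\<phi>. r *\<^sub>R \<phi> \<in> A}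
      = ennreal (?k * pareto_weight v s' r) * emeasure (density \<sigma> \<psi>) {\<phi>. r *\<^sub>R \<phi> \<in> A}"
    proof cases
      case 1
      moreover have "v powr (- s') * v powr s' = 1"
        using assms by (simp flip: powr_add)
      ultimately have "p * s' * pareto_weight t s' r = ?k * pareto_weight v s' r"
        using assms by (simp add: pareto_weight_def)
      then show ?thesis by (simp only:)
    next
      case 2
      then show ?thesis using assms by (simp add: pareto_weight_def)
    next
      case 3
      have "emeasure (density \<sigma> \<psi>) {\<phi>. r *\<^sub>R \<phi> \<in> A} = emeasure (density \<sigma> \<psi>) {}"
      proof (rule emeasure_eq_AE)
        show "AE \<phi> in density \<sigma> \<psi>. \<phi> \<in> {\<phi>. r *\<^sub>R \<phi> \<in> A} \<longleftrightarrow> \<phi> \<in> {}"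
          using AE_density_surface_measure[OF measurable_compose[OF \<open>\<psi> \<in> borel_measurable borel\<close> measurable_ennreal]]
        proof eventually_elim
          case (elim \<phi>)
          then have "norm (r *\<^sub>R \<phi>) \<le> v"
            using 3 \<open>0 < t\<close> by (simp add: unit_directions_def)
          then show ?case using assms by force
        qed
      qed auto
      then show ?thesis by simp
    qed
  qed
  finally have "measure Q A = ?k * (\<integral>r. pareto_weight v s' r
      * enn2real (emeasure (density \<sigma> \<psi>) {\<phi>. r *\<^sub>R \<phi> \<in> A}) \<partial>lborel)"
    using assms finite_measure.emeasure_finite[OF fin]
    by (intro measure_eq_pareto_integral measurable_section_density) auto
  then show ?thesis
    using assms by (simp add: measure_def powr_minus)
qed

text \<open>\<open>limit_measure\<close> is not normalised, whereas the angular laws and their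
  estimates are probabilities; this is the factor between the two scales.\<close>

definition angular_mass :: real where
  "angular_mass = measure limit_measure UNIV"

text \<open>If the mass were 0, positivity of \<open>phi_star\<close> would leave almost no
  direction in \<open>E\<close>; then polar integration of \<open>f\<close>, which vanishes off the
  cone, would give \<open>P\<close> total mass 0 instead of 1.\<close>

lemma angular_mass_pos: "0 < angular_mass"
proof (rule ccontr)
  assume "\<not> 0 < angular_mass"
  then have "measure limit_measure UNIV = 0"
    unfolding angular_mass_def using measure_nonneg[of limit_measure UNIV] by linarith
  then have "emeasure limit_measure UNIV = 0"
    by (simp add: LM.emeasure_eq_measure)
  then have "(\<integral>\<^sup>+ \<phi>. ennreal (limit_density \<phi>) \<partial>\<sigma>) = 0"
    by (simp add: limit_measure_def emeasure_density)
  then have "AE \<phi> in \<sigma>. ennreal (limit_density \<phi>) = 0"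
    by (subst (asm) nn_integral_0_iff_AE) auto
  with AE_surface_measure have "AE \<phi> in \<sigma>. False"
    by eventually_elim (use limit_density_pos in \<open>force simp: ennreal_eq_0_iff\<close>)
  then have "AE \<phi> in sphere_surface. \<phi> \<notin> unit_directions E"
    unfolding surface_measure_def
    by (subst (asm) AE_density) (auto simp: indicator_def elim!: eventually_mono)
  with AE_sphere_surface have "AE \<phi> in sphere_surface. \<phi> \<notin> E"
    by eventually_elim (simp add: unit_directions_def)
  then have ae: "AE \<phi> in sphere_surface. ennreal (r ^ (DIM('a) - 1)) * indicator {0<..} r * ennreal (f (r *\<^sub>R \<phi>)) = 0" for r
    by eventually_elim (auto simp: indicator_def scaleR_in_E_iff f_outside)
  have "emeasure P UNIV = (\<integral>\<^sup>+ x. ennreal (f x) \<partial>lborel)"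
    by (simp add: density emeasure_density)
  also have "\<dots> = (\<integral>\<^sup>+ r. \<integral>\<^sup>+ \<phi>. ennreal (r ^ (DIM('a) - 1)) * indicator {0<..} r * ennreal (f (r *\<^sub>R \<phi>))
      \<partial>sphere_surface \<partial>lborel)"
    by (intro nn_integral_polar) simp
  also have "\<dots> = (\<integral>\<^sup>+ r. \<integral>\<^sup>+ \<phi>. 0 \<partial>(sphere_surface :: 'a measure) \<partial>(lborel :: real measure))"
    by (intro nn_integral_cong nn_integral_cong_AE ae)
  finally show False
    using prob_space.emeasure_space_1[OF prob_space_P] by simp
qed

text \<open>The prefactors turn both masses into integrals against Pareto weights starting at
  \<open>v\<close>, so that \<open>pareto_integral_compare\<close> applies section by section. The
  angular error \<open>\<epsilon>\<close> is left abstract and is supplied in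
  \<open>stressed_law_distance\<close>. The last clause serves both the tail of the norm, with
  \<open>B = UNIV\<close>, and the angular law at \<open>t\<close>.\<close>

lemma tail_compare:
  obtains C T where "C \<ge> 0" "T > 0"
    "\<And>v t p s' \<psi> Q A \<epsilon>. \<lbrakk>T \<le> v; 0 < t; t \<le> v; 0 < p; 0 < s'; \<psi> \<in> borel_measurable borel;
      prob_space (density \<sigma> \<psi>); ssgen_law E t p s' \<psi> Q; A \<in> sets borel; A \<subseteq> {x. norm x > v};
      \<And>B. B \<in> sets borel \<Longrightarrow> \<bar>measure limit_measure B - angular_mass * measure (density \<sigma> \<psi>) B\<bar> \<le> \<epsilon>\<rbrakk>
      \<Longrightarrow> \<bar>v powr s * measure P A - angular_mass * (v powr s' / (p * s' * t powr s')) * measure Q A\<bar>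
        \<le> (C * v powr (- \<gamma>) + \<epsilon>) / s + angular_mass * \<bar>1 / s - 1 / s'\<bar>"
    "\<And>t B. \<lbrakk>T \<le> t; B \<in> sets borel\<rbrakk>
      \<Longrightarrow> \<bar>s * t powr s * measure P {x. norm x > t \<and> sgn x \<in> B} - measure limit_measure B\<bar> \<le> C * t powr (- \<gamma>)"
proof -
  obtain C T where CT: "C \<ge> 0" "T > 0"
    and close: "\<And>v r B. T \<le> v \<Longrightarrow> v < r \<Longrightarrow> B \<in> sets borel
      \<Longrightarrow> \<bar>measure (density \<sigma> (scaled_density r)) B - measure limit_measure B\<bar> \<le> C * v powr (- \<gamma>)"
    and fin: "\<And>r. T < r \<Longrightarrow> finite_measure (density \<sigma> (scaled_density r))"
    using scaled_density_limit by blast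
  show thesis
  proof (rule that[OF CT])
    fix v t p s' and \<psi> :: "'a \<Rightarrow> real" and Q and A :: "'a set" and \<epsilon>
    assume v: "T \<le> v" "0 < t" "t \<le> v" "0 < p" "0 < s'"
      and [measurable]: "\<psi> \<in> borel_measurable borel"
      and prob: "prob_space (density \<sigma> \<psi>)" and gen: "ssgen_law E t p s' \<psi> Q"
      and A[measurable]: "A \<in> sets borel" and sub: "A \<subseteq> {x. norm x > v}"
      and \<epsilon>: "\<And>B. B \<in> sets borel \<Longrightarrow> \<bar>measure limit_measure B - angular_mass * measure (density \<sigma> \<psi>) B\<bar> \<le> \<epsilon>"
    interpret prob: prob_space "density \<sigma> \<psi>" by fact
    have [measurable]: "{\<phi>. r *\<^sub>R \<phi> \<in> A} \<in> sets borel" for r :: real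
      by measurable
    let ?a = "\<lambda>r. measure (density \<sigma> (scaled_density r)) {\<phi>. r *\<^sub>R \<phi> \<in> A}"
    let ?b = "\<lambda>r. angular_mass * measure (density \<sigma> \<psi>) {\<phi>. r *\<^sub>R \<phi> \<in> A}"
    have "v powr s * measure P A = (\<integral>r. pareto_weight v s r * ?a r \<partial>lborel)"
      using v sub CT fin by (intro measure_P_section) auto
    moreover have "angular_mass * (v powr s' / (p * s' * t powr s')) * measure Q A
        = (\<integral>r. pareto_weight v s' r * ?b r \<partial>lborel)"
    proof -
      have "(\<integral>r. pareto_weight v s' r * ?b r \<partial>lborel)
          = angular_mass * (\<integral>r. pareto_weight v s' r * prob.prob {\<phi>. r *\<^sub>R \<phi> \<in> A} \<partial>lborel)"
        by (simp add: mult.left_commute[of _ angular_mass])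
      also have "(\<integral>r. pareto_weight v s' r * prob.prob {\<phi>. r *\<^sub>R \<phi> \<in> A} \<partial>lborel)
          = v powr s' / (p * s' * t powr s') * measure Q A"
        using v prob.finite_measure_axioms by (intro measure_ssgen_section[OF gen, symmetric] sub) auto
      finally show ?thesis by (simp only: mult.assoc)
    qed
    moreover have "\<bar>(\<integral>r. pareto_weight v s r * ?a r \<partial>lborel) - (\<integral>r. pareto_weight v s' r * ?b r \<partial>lborel)\<bar>
        \<le> (C * v powr (- \<gamma>) + \<epsilon>) / s + angular_mass * \<bar>1 / s - 1 / s'\<bar>"
    proof (rule pareto_integral_compare(2))
      show "?a \<in> borel_measurable borel"
        unfolding measure_def using measurable_section_density[of scaled_density A] by simp
      show "?b \<in> borel_measurable borel"
        unfolding measure_def using measurable_section_density[of "\<lambda>_. \<psi>" A] by simp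
      show "\<bar>?a r - ?b r\<bar> \<le> C * v powr (- \<gamma>) + \<epsilon>" if "v < r" for r
        using close[of v r "{\<phi>. r *\<^sub>R \<phi> \<in> A}"] \<epsilon>[of "{\<phi>. r *\<^sub>R \<phi> \<in> A}"] v that by simp
      show "?b r \<le> angular_mass" "0 \<le> ?b r" for r
        using angular_mass_pos by (simp_all add: mult_left_le)
    qed (use v CT s_pos in auto)
    ultimately show "\<bar>v powr s * measure P A - angular_mass * (v powr s' / (p * s' * t powr s')) * measure Q A\<bar>
        \<le> (C * v powr (- \<gamma>) + \<epsilon>) / s + angular_mass * \<bar>1 / s - 1 / s'\<bar>"
      by simp
  next
    fix t and B :: "'a set" assume t: "T \<le> t" and [measurable]: "B \<in> sets borel"
    let ?A = "{x. norm x > t \<and> sgn x \<in> B}"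
    let ?a = "\<lambda>r. measure (density \<sigma> (scaled_density r)) {\<phi>. r *\<^sub>R \<phi> \<in> ?A}"
    have A [measurable]: "?A \<in> sets borel" by measurable
    have [measurable]: "{\<phi>. r *\<^sub>R \<phi> \<in> ?A} \<in> sets borel" for r :: real
      by measurable
    have "t powr s * measure P ?A = (\<integral>r. pareto_weight t s r * ?a r \<partial>lborel)"
      using t CT fin by (intro measure_P_section) auto
    \<comment> \<open>The same comparison with equal indices and a constant second function, so that
      the term in \<open>1 / s - 1 / s\<close> vanishes.\<close>
    moreover have "\<bar>(\<integral>r. pareto_weight t s r * ?a r \<partial>lborel)
          - (\<integral>r. pareto_weight t s r * measure limit_measure B \<partial>lborel)\<bar>
        \<le> C * t powr (- \<gamma>) / s + measure limit_measure B * \<bar>1 / s - 1 / s\<bar>"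
    proof (rule pareto_integral_compare(2))
      show "?a \<in> borel_measurable borel"
        unfolding measure_def using measurable_section_density[OF _ A, of scaled_density] by simp
      show "\<bar>?a r - measure limit_measure B\<bar> \<le> C * t powr (- \<gamma>)" if "t < r" for r
      proof -
        \<comment> \<open>For \<open>r > t\<close> every unit vector meets the norm condition and is
          fixed by \<open>sgn\<close> after scaling, so the section is \<open>B\<close> up to a null
          set.\<close>
        have "emeasure (density \<sigma> (scaled_density r)) {\<phi>. r *\<^sub>R \<phi> \<in> ?A}
            = emeasure (density \<sigma> (scaled_density r)) B"
        proof (rule emeasure_eq_AE)
          show "AE \<phi> in density \<sigma> (scaled_density r). \<phi> \<in> {\<phi>. r *\<^sub>R \<phi> \<in> ?A} \<longleftrightarrow> \<phi> \<in> B"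
            using AE_density_surface_measure[of "scaled_density r"]
            by (auto elim!: eventually_mono) (use that t CT in \<open>auto simp: unit_directions_def sgn_div_norm\<close>)
        qed auto
        then show ?thesis
          using close[of t r B] t that by (simp add: measure_def)
      qed
    qed (use t CT s_pos in auto)
    moreover have "(\<integral>r. pareto_weight t s r * measure limit_measure B \<partial>lborel) = measure limit_measure B / s"
      using has_bochner_integral_integral_eq[OF has_integral_pareto_weight[of t s]] t CT s_pos by simp
    ultimately have "\<bar>t powr s * measure P ?A - measure limit_measure B / s\<bar> \<le> C * t powr (- \<gamma>) / s"
      by simp
    then have "s * \<bar>t powr s * measure P ?A - measure limit_measure B / s\<bar> \<le> C * t powr (- \<gamma>)"
      using s_pos by (simp add: field_simps)
    then show "\<bar>s * t powr s * measure P ?A - measure limit_measure B\<bar> \<le> C * t powr (- \<gamma>)"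
      using s_pos abs_mult[of s "t powr s * measure P ?A - measure limit_measure B / s"]
      by (simp add: right_diff_distrib mult.assoc)
  qed
qed

end

subsection \<open>Stressed laws and stress sets\<close>

lemma total_variation_bounds:
  assumes "prob_space M" "prob_space N" "B \<in> sets M"
  shows "\<bar>measure M B - measure N B\<bar> \<le> total_variation M N"
  unfolding total_variation_def
proof (rule cSUP_upper)
  have "\<bar>measure M A - measure N A\<bar> \<le> 1" for A
    using prob_space.prob_le_1[OF assms(1), of A] prob_space.prob_le_1[OF assms(2), of A]
      measure_nonneg[of M A] measure_nonneg[of N A] by linarith
  then show "bdd_above ((\<lambda>B. \<bar>measure M B - measure N B\<bar>) ` sets M)"
    by (auto simp: bdd_above_def)
qed fact

lemma total_variation_least:
  assumes "\<And>B. B \<in> sets M \<Longrightarrow> \<bar>measure M B - measure N B\<bar> \<le> \<delta>"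
  shows "total_variation M N \<le> \<delta>"
  unfolding total_variation_def by (rule cSUP_least) (use assms in auto)

lemma total_variation_nonneg:
  assumes "prob_space M" "prob_space N"
  shows "0 \<le> total_variation M N"
  using total_variation_bounds[OF assms, of "{}"] by simp

lemma prob_space_stressed_law:
  assumes "prob_space D" "sets Q = sets borel" "prob_space Q"
  shows "prob_space (stressed_law D Q u S)"
proof (cases "measure Q S = 0")
  case False
  interpret Q: prob_space Q by fact
  have "prob_space (uniform_measure Q S)"
    using False by (intro prob_space_uniform_measure) (auto simp: Q.emeasure_eq_measure)
  then show ?thesis
    using False assms(2) by (simp add: stressed_law_def)
      (intro prob_space.prob_space_distr; simp add: measurable_cong_sets[OF sets_uniform_measure refl] cong: measurable_cong_sets)
qed (use assms in \<open>simp add: stressed_law_def\<close>)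

lemma sets_stressed_law: "sets D = sets borel \<Longrightarrow> sets (stressed_law D Q u S) = sets borel"
  by (simp add: stressed_law_def)

lemma measure_stressed_law:
  assumes "prob_space Q" "sets Q = sets borel" "measure Q S \<noteq> 0" and [measurable]: "B \<in> sets borel"
  shows "measure (stressed_law D Q u S) B = measure Q (S \<inter> {x. x /\<^sub>R u \<in> B}) / measure Q S"
proof -
  interpret Q: prob_space Q by fact
  have [measurable_cong]: "sets Q = sets borel" by fact
  have "{x. x /\<^sub>R u \<in> B} \<in> sets Q" by measurable
  moreover have "space Q = UNIV"
    using sets_eq_imp_space_eq[OF assms(2)] by simp
  moreover have "measure (distr (uniform_measure Q S) borel (\<lambda>x. x /\<^sub>R u)) B
      = measure (uniform_measure Q S) ((\<lambda>x. x /\<^sub>R u) -` B \<inter> space (uniform_measure Q S))"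
    by (rule measure_distr) (simp_all cong: measurable_cong_sets add: assms(2))
  ultimately show ?thesis
    using assms(3) by (simp add: stressed_law_def vimage_def Q.emeasure_eq_measure)
qed

text \<open>Each constant cancels in its own quotient. With \<open>p\<close>, \<open>q\<close> the
  scaled masses of \<open>S\<close> under \<open>P\<close>, \<open>Q\<close> and \<open>a\<close>,
  \<open>b\<close> those of its part mapped into \<open>B\<close>, the difference
  \<open>b / q - a / p\<close> equals \<open>((b / q) * (p - q) + (b - a)) / p\<close>, and
  \<open>b / q \<le> 1\<close>. The two errors \<open>\<delta>\<close> give the factor 2, and a
  small \<open>q\<close> costs nothing.\<close>

lemma total_variation_stressed_law_le:
  assumes Q: "prob_space Q" "sets Q = sets borel" and P: "prob_space P" "sets P = sets borel"
    and D: "prob_space D" "sets D = sets borel" and D': "prob_space D'" "sets D' = sets borel"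
    and S: "S \<in> sets borel" and "0 < k" "0 < k'" and pos: "0 < measure P S"
    and close: "\<And>A. A \<in> sets borel \<Longrightarrow> A \<subseteq> S \<Longrightarrow> \<bar>k * measure P A - k' * measure Q A\<bar> \<le> \<delta>"
  shows "total_variation (stressed_law D' Q u S) (stressed_law D P u S) \<le> 2 * \<delta> / (k * measure P S)"
proof (rule total_variation_least)
  fix B assume "B \<in> sets (stressed_law D' Q u S)"
  then have B [measurable]: "B \<in> sets borel"
    using D' by (simp add: sets_stressed_law)
  interpret \<Pi>': prob_space "stressed_law D' Q u S"
    using Q D' by (intro prob_space_stressed_law)
  interpret \<Pi>: prob_space "stressed_law D P u S"
    using P D by (intro prob_space_stressed_law)
  define p where "p = k * measure P S"
  have "p > 0" using pos \<open>0 < k\<close> by (simp add: p_def)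
  show "\<bar>\<Pi>'.prob B - \<Pi>.prob B\<bar> \<le> 2 * \<delta> / (k * measure P S)"
  proof (cases "measure Q S = 0")
    \<comment> \<open>Here the arbitrary default law takes over; but then
      \<open>p \<le> \<delta>\<close>, so the claimed bound is at least 2 and holds
      trivially.\<close>
    case True
    then have "p \<le> \<delta>" using close[OF S order_refl] by (simp add: p_def)
    then have "1 \<le> 2 * \<delta> / p" using \<open>p > 0\<close> by (simp add: field_simps)
    moreover have "\<bar>\<Pi>'.prob B - \<Pi>.prob B\<bar> \<le> 1"
      using \<Pi>'.prob_le_1[of B] \<Pi>.prob_le_1[of B] measure_nonneg[of _ B] by (smt (verit))
    ultimately show ?thesis by (simp add: p_def)
  next
    case False
    let ?A = "S \<inter> {x. x /\<^sub>R u \<in> B}"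
    have A: "?A \<in> sets borel" using S by measurable
    define q a b where "q = k' * measure Q S" and "a = k * measure P ?A" and "b = k' * measure Q ?A"
    have "q > 0" "b \<ge> 0" "b \<le> q"
      using False \<open>0 < k'\<close> S Q by (auto simp: q_def b_def less_le intro!: mult_left_mono
        finite_measure.finite_measure_mono prob_space.finite_measure)
    have "\<bar>a - b\<bar> \<le> \<delta>" "\<bar>p - q\<bar> \<le> \<delta>"
      using close[OF A] close[OF S order_refl] by (auto simp: a_def b_def p_def q_def)
    have "\<Pi>'.prob B - \<Pi>.prob B = b / q - a / p"
      using False pos \<open>0 < k\<close> \<open>0 < k'\<close> Q P
      by (simp add: measure_stressed_law a_def b_def p_def q_def)
    also have "\<dots> = ((b / q) * (p - q) + (b - a)) / p"
      using \<open>p > 0\<close> \<open>q > 0\<close> by (simp add: field_simps)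
    finally have "\<bar>\<Pi>'.prob B - \<Pi>.prob B\<bar> = \<bar>(b / q) * (p - q) + (b - a)\<bar> / p"
      using \<open>p > 0\<close> by simp
    moreover have "\<bar>(b / q) * (p - q)\<bar> \<le> \<bar>p - q\<bar>"
      unfolding abs_mult using \<open>q > 0\<close> \<open>b \<ge> 0\<close> \<open>b \<le> q\<close> by (intro mult_left_le_one_le) auto
    then have "\<bar>(b / q) * (p - q) + (b - a)\<bar> / p \<le> 2 * \<delta> / p"
      using \<open>\<bar>a - b\<bar> \<le> \<delta>\<close> \<open>\<bar>p - q\<bar> \<le> \<delta>\<close> \<open>p > 0\<close> by (intro divide_right_mono) linarith+
    ultimately show ?thesis by (simp add: p_def)
  qed
qed

section \<open>Location and mass of the stress sets\<close>

lemma homogeneous_limit_at: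
  assumes "asymptotically_homogeneous_system E K L Lstar" "j \<in> {1..K}" "z \<in> E"
  shows "((\<lambda>t. L j (t *\<^sub>R z) / t) \<longlongrightarrow> Lstar j z) at_top"
  using assms unfolding asymptotically_homogeneous_system_def
  by (elim ballE[where x = j] conjE ballE[where x = z] allE[where x = "\<lambda>_. z"]) auto

text \<open>Along the constant path at the origin the loss is the fixed number \<open>L j 0\<close>,
  which division by the scale sends to 0. Hence the origin never belongs to a limiting stress
  set.\<close>

lemma homogeneous_limit_zero:
  assumes "asymptotically_homogeneous_system E K L Lstar" "j \<in> {1..K}" "cone E"
  shows "0 \<in> E" "Lstar j 0 = 0"
proof -
  obtain z where "z \<in> E"
    using assms by (auto simp: asymptotically_homogeneous_system_def)
  then have "0 *\<^sub>R z \<in> E"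
    using \<open>cone E\<close> unfolding cone_def by blast
  then show "0 \<in> E" by simp
  from homogeneous_limit_at[OF assms(1,2) this]
  have "((\<lambda>t. L j 0 / t) \<longlongrightarrow> Lstar j 0) at_top" by simp
  moreover have "((\<lambda>t. L j 0 / t) \<longlongrightarrow> 0) at_top"
    by (intro tendsto_divide_0[OF tendsto_const] filterlim_at_top_imp_at_infinity filterlim_ident)
  ultimately show "Lstar j 0 = 0"
    by (rule tendsto_unique[OF trivial_limit_at_top_linorder])
qed

text \<open>Points with loss at least \<open>u\<close> but norm \<open>o(u)\<close> would, after division by \<open>u\<close>, give a path
  in \<open>E\<close> converging to the origin along which the scaled loss does not tend to \<open>Lstar j 0 = 0\<close>.\<close>

lemma stress_set_far:
  assumes sys: "asymptotically_homogeneous_system E K L Lstar" and "j \<in> J" "j \<in> {1..K}" and "cone E"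
  obtains c U where "c > 0" "\<And>u. U \<le> u \<Longrightarrow> stress_set E L u J \<subseteq> {x. norm x > c * u}"
proof (rule ccontr)
  note obtained = that
  assume "\<not> thesis"
  then have no: "\<exists>u\<ge>U. \<not> stress_set E L u J \<subseteq> {x. norm x > c * u}" if "c > 0" for c U
    using obtained[OF that, of U] by blast
  have "\<exists>u x. u \<ge> real (Suc k) \<and> x \<in> E \<and> L j x \<ge> u \<and> norm x \<le> u / real (Suc k)" for k
    using no[of "1 / real (Suc k)" "real (Suc k)"] \<open>j \<in> J\<close> by (force simp: stress_set_def not_less)
  then obtain u x where ux: "\<And>k. u k \<ge> real (Suc k)" "\<And>k. x k \<in> E" "\<And>k. L j (x k) \<ge> u k"
      "\<And>k. norm (x k) \<le> u k / real (Suc k)"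
    by metis
  have upos: "u k > 0" for k using ux(1)[of k] by linarith
  \<comment> \<open>\<open>u\<close> need not be injective, so an index is chosen for each level
    attained. Elsewhere the path rests at the origin, so that it stays in \<open>E\<close> and is
    defined at all real scales, as the limit condition on the losses requires.\<close>
  define w where "w t = (if t \<in> range u then x (SOME k. u k = t) /\<^sub>R t else 0)" for t
  have some: "\<exists>k'. u k' = t \<and> w t = x k' /\<^sub>R t" if "t = u k" for k t
    using that someI[of "\<lambda>k. u k = t" k] by (auto simp: w_def)
  note zero = homogeneous_limit_zero[OF sys \<open>j \<in> {1..K}\<close> \<open>cone E\<close>]
  have "w t \<in> E" for t
  proof (cases "t \<in> range u")
    case True
    then obtain k where "u k = t" "w t = x k /\<^sub>R t" using some by blast
    then show ?thesis
      using ux(2)[of k] upos[of k] \<open>cone E\<close> by (auto simp: cone_def)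
  qed (simp add: w_def zero)
  moreover have "(w \<longlongrightarrow> 0) at_top"
  proof (rule tendstoI)
    fix e :: real assume "e > 0"
    then obtain N where N: "1 / real (Suc N) < e"
      using nat_approx_posE by blast
    \<comment> \<open>Beyond the levels of the indices up to \<open>N\<close>, any index attaining
      the level \<open>t\<close> exceeds \<open>N\<close>, whichever one was chosen.\<close>
    have "eventually (\<lambda>t. Max (u ` {..N}) < t) at_top"
      by (rule eventually_gt_at_top)
    then show "eventually (\<lambda>t. dist (w t) 0 < e) at_top"
    proof eventually_elim
      case (elim t)
      show ?case
      proof (cases "t \<in> range u")
        case True
        then obtain k where k: "u k = t" "w t = x k /\<^sub>R t" using some by blast
        have "\<not> k \<le> N" using elim k(1) by auto
        have "norm (w t) \<le> 1 / real (Suc k)"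
          using ux(4)[of k] upos[of k] k by (simp add: field_simps)
        also have "\<dots> \<le> 1 / real (Suc N)"
          using \<open>\<not> k \<le> N\<close> by (intro divide_left_mono) auto
        finally show ?thesis using N by simp
      qed (simp add: w_def \<open>e > 0\<close>)
    qed
  qed
  ultimately have "((\<lambda>t. L j (t *\<^sub>R w t) / t) \<longlongrightarrow> Lstar j 0) at_top"
    using sys \<open>j \<in> {1..K}\<close> zero unfolding asymptotically_homogeneous_system_def
    by (elim ballE[where x = j] conjE ballE[where x = 0] allE[where x = w]) auto
  then have "((\<lambda>t. L j (t *\<^sub>R w t) / t) \<longlongrightarrow> 0) at_top"
    by (simp add: zero)
  moreover have "filterlim u at_top sequentially"
  proof (rule filterlim_at_top_mono[OF filterlim_real_sequentially])
    show "eventually (\<lambda>k. real k \<le> u k) sequentially"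
      using ux(1) by (intro always_eventually allI) (smt (verit) of_nat_Suc)
  qed
  ultimately have "(\<lambda>k. L j (u k *\<^sub>R w (u k)) / u k) \<longlonglongrightarrow> 0"
    by (rule filterlim_compose)
  then have "eventually (\<lambda>k. L j (u k *\<^sub>R w (u k)) / u k < 1) sequentially"
    by (rule order_tendstoD) simp
  moreover have "1 \<le> L j (u k *\<^sub>R w (u k)) / u k" for k
  proof -
    obtain k' where "u k' = u k" "w (u k) = x k' /\<^sub>R u k" using some by blast
    then show ?thesis using ux(3)[of k'] upos[of k] by (simp add: field_simps)
  qed
  ultimately show False
    by (auto simp: not_less[symmetric] dest: eventually_happens)
qed

lemma stress_set_borel:
  assumes "asymptotically_homogeneous_system E K L Lstar" "J \<subseteq> {1..K}" "closed E"
  shows "stress_set E L u J \<in> sets borel"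
proof -
  have "{z \<in> E. u \<le> L j z} \<in> sets borel" if "j \<in> J" for j
  proof -
    have "L j \<in> borel_measurable (restrict_space borel E)"
      using assms that by (auto simp: asymptotically_homogeneous_system_def)
    then have "{z \<in> space (restrict_space borel E). u \<le> L j z} \<in> sets (restrict_space borel E)"
      by measurable
    then show ?thesis
      using \<open>closed E\<close> by (simp add: space_restrict_space sets_restrict_space_iff)
  qed
  moreover have "finite J"
    using assms(2) finite_subset by blast
  moreover have "stress_set E L u J = E \<inter> (\<Inter>j\<in>J. {z \<in> E. u \<le> L j z}) \<or> J = {}"
    by (auto simp: stress_set_def)
  moreover have "stress_set E L u {} = E"
    by (auto simp: stress_set_def)
  moreover have "E \<in> sets borel" using \<open>closed E\<close> by simp
  ultimately show ?thesis
    by (cases "J = {}") (auto intro!: sets.Int sets.finite_INT)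
qed

context regularly_varying_model
begin

lemma nn_integral_P_scale:
  assumes "u > 0" and [measurable]: "S \<in> sets borel"
  shows "ennreal (u powr s) * emeasure P S
    = (\<integral>\<^sup>+ z. ennreal (u powr (s + real DIM('a)) * f (u *\<^sub>R z)) * indicator S (u *\<^sub>R z) \<partial>lborel)"
proof -
  have "emeasure P S = (\<integral>\<^sup>+ x. ennreal (f x) * indicator S x \<partial>lborel)"
    by (simp add: density emeasure_density)
  also have "\<dots> = ennreal (u ^ DIM('a)) * (\<integral>\<^sup>+ z. ennreal (f (u *\<^sub>R z)) * indicator S (u *\<^sub>R z) \<partial>lborel)"
    using \<open>u > 0\<close> by (intro nn_integral_lborel_scale) auto
  finally have "ennreal (u powr s) * emeasure P S
      = ennreal (u powr s * u ^ DIM('a)) * (\<integral>\<^sup>+ z. ennreal (f (u *\<^sub>R z)) * indicator S (u *\<^sub>R z) \<partial>lborel)"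
    using \<open>u > 0\<close> by (simp add: ennreal_mult mult.assoc)
  also have "u powr s * u ^ DIM('a) = u powr (s + real DIM('a))"
    using \<open>u > 0\<close> by (simp add: powr_add powr_realpow)
  also have "ennreal (u powr (s + real DIM('a))) * (\<integral>\<^sup>+ z. ennreal (f (u *\<^sub>R z)) * indicator S (u *\<^sub>R z) \<partial>lborel)
      = (\<integral>\<^sup>+ z. ennreal (u powr (s + real DIM('a)) * f (u *\<^sub>R z)) * indicator S (u *\<^sub>R z) \<partial>lborel)"
    by (subst nn_integral_cmult[symmetric]) (auto simp: ennreal_mult f_nonneg mult.assoc)
  finally show ?thesis .
qed

text \<open>Rescaling by \<open>2 * u n\<close> instead of \<open>u n\<close> turns the level into 1/2, so that every point of the
  limiting stress set at level 1 is eventually a rescaled stressed point.\<close>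

lemma stress_set_mass:
  assumes sys: "asymptotically_homogeneous_system E K L Lstar" and J: "J \<subseteq> {1..K}" "J \<noteq> {}"
    and pos: "emeasure lebesgue (stress_set E Lstar 1 J) \<noteq> 0"
    and u: "filterlim u at_top sequentially"
  obtains c where "c > 0" "eventually (\<lambda>n. c \<le> u n powr s * measure P (stress_set E L (u n) J)) sequentially"
proof -
  interpret P: prob_space P by (rule prob_space_P)
  note [measurable] = stress_set_borel[OF sys J(1) closed_E]
  let ?v = "\<lambda>n. 2 * u n"
  let ?g = "\<lambda>n z. ennreal (?v n powr (s + real DIM('a)) * f (?v n *\<^sub>R z)) * indicator (stress_set E L (u n) J) (?v n *\<^sub>R z)"
  have v: "filterlim ?v at_top sequentially"
    by (rule filterlim_tendsto_pos_mult_at_top[OF tendsto_const _ u]) simp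
  have lim: "liminf (\<lambda>n. ?g n z) \<noteq> 0" if z: "z \<in> stress_set E Lstar 1 J" for z
  proof -
    obtain j0 where "j0 \<in> J" using J by auto
    \<comment> \<open>\<open>Lstar j0\<close> is at least 1 at \<open>z\<close> but 0 at the origin.
      This matters because regular variation is available only away from the origin.\<close>
    then have "z \<noteq> 0"
      using z homogeneous_limit_zero(2)[OF sys _ cone_E, of j0] J by (force simp: stress_set_def)
    have zE: "z \<in> E" using z by (simp add: stress_set_def)
    have "eventually (\<lambda>n. \<forall>j\<in>J. L j (?v n *\<^sub>R z) / ?v n > 1 / 2) sequentially"
    proof (rule eventually_ball_finite)
      show "finite J" using J(1) finite_subset by blast
      show "\<forall>j\<in>J. eventually (\<lambda>n. L j (?v n *\<^sub>R z) / ?v n > 1 / 2) sequentially"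
      proof
        fix j assume "j \<in> J"
        then have "(\<lambda>n. L j (?v n *\<^sub>R z) / ?v n) \<longlonglongrightarrow> Lstar j z"
          using J by (intro filterlim_compose[OF homogeneous_limit_at[OF sys _ zE] v]) auto
        moreover have "1 / 2 < Lstar j z"
          using z \<open>j \<in> J\<close> by (force simp: stress_set_def)
        ultimately show "eventually (\<lambda>n. L j (?v n *\<^sub>R z) / ?v n > 1 / 2) sequentially"
          by (rule order_tendstoD)
      qed
    qed
    moreover have "eventually (\<lambda>n. u n > 0) sequentially"
      using u filterlim_at_top_dense by blast
    ultimately have ind: "eventually (\<lambda>n. ?v n *\<^sub>R z \<in> stress_set E L (u n) J) sequentially"
    proof eventually_elim
      case (elim n)
      then show ?case
        using scaleR_in_E[OF zE, of "?v n"] by (auto simp: stress_set_def field_simps less_imp_le)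
    qed
    have "(\<lambda>n. ?v n powr (s + real DIM('a)) * f (?v n *\<^sub>R z)) \<longlonglongrightarrow> phi_star z"
      using zE \<open>z \<noteq> 0\<close> by (intro filterlim_compose[OF regular_variation_at v]) auto
    then have "(\<lambda>n. ennreal (?v n powr (s + real DIM('a)) * f (?v n *\<^sub>R z))) \<longlonglongrightarrow> ennreal (phi_star z)"
      by (rule tendsto_ennrealI)
    then have "(\<lambda>n. ?g n z) \<longlonglongrightarrow> ennreal (phi_star z)"
      by (rule Lim_transform_eventually) (use ind in eventually_elim, simp)
    then have "liminf (\<lambda>n. ?g n z) = ennreal (phi_star z)"
      by (intro lim_imp_Liminf) auto
    moreover have "0 < phi_star z"
      using regular_variation zE \<open>z \<noteq> 0\<close> by (auto simp: density_regularly_varying_def)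
    ultimately show ?thesis by simp
  qed
  have "(\<integral>\<^sup>+ z. liminf (\<lambda>n. ?g n z) \<partial>lborel) \<noteq> 0"
  proof
    assume "(\<integral>\<^sup>+ z. liminf (\<lambda>n. ?g n z) \<partial>lborel) = 0"
    then have "emeasure lborel {z \<in> space lborel. liminf (\<lambda>n. ?g n z) \<noteq> 0} = 0"
      by (subst (asm) nn_integral_0_iff) auto
    moreover have N: "{z \<in> space lborel. liminf (\<lambda>n. ?g n z) \<noteq> 0} \<in> sets lborel"
      by measurable
    \<comment> \<open>Measurability of the limiting stress set has not been established; instead it
      is enclosed in the Borel set where the liminf is nonzero, which would be null.\<close>
    moreover have "emeasure lebesgue (stress_set E Lstar 1 J)
        \<le> emeasure lebesgue {z \<in> space lborel. liminf (\<lambda>n. ?g n z) \<noteq> 0}"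
      using lim sets_completionI_sets[OF N] by (intro emeasure_mono) auto
    ultimately have "emeasure lebesgue (stress_set E Lstar 1 J) \<le> 0"
      by (simp only: emeasure_completion[OF sets_completionI_sets[OF N]] main_part[OF N])
    with pos show False by simp
  qed
  moreover have "(\<integral>\<^sup>+ z. liminf (\<lambda>n. ?g n z) \<partial>lborel) \<le> liminf (\<lambda>n. \<integral>\<^sup>+ z. ?g n z \<partial>lborel)"
    by (intro nn_integral_liminf) simp
  ultimately have "0 < liminf (\<lambda>n. \<integral>\<^sup>+ z. ?g n z \<partial>lborel)"
    unfolding zero_less_iff_neq_zero by (auto simp: le_zero_eq)
  then obtain c where c: "0 < c" "c < liminf (\<lambda>n. \<integral>\<^sup>+ z. ?g n z \<partial>lborel)"
    using dense by blast
  then have "c \<noteq> \<top>" by auto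
  with c(1) obtain c' where c': "c = ennreal c'" "c' > 0"
    by (cases c) auto
  have "eventually (\<lambda>n. c < (\<integral>\<^sup>+ z. ?g n z \<partial>lborel)) sequentially"
    using c(2) by (rule less_LiminfD)
  moreover have "eventually (\<lambda>n. u n > 0) sequentially"
    using u filterlim_at_top_dense by blast
  \<comment> \<open>The divisor \<open>2 powr s\<close> undoes the rescaling by
    \<open>2 * u n\<close> in place of \<open>u n\<close>.\<close>
  ultimately have "eventually (\<lambda>n. c' / 2 powr s \<le> u n powr s * measure P (stress_set E L (u n) J)) sequentially"
  proof eventually_elim
    case (elim n)
    have "ennreal c' < ennreal (?v n powr s) * emeasure P (stress_set E L (u n) J)"
      using elim nn_integral_P_scale[of "?v n" "stress_set E L (u n) J"] c' by simp
    then have "c' < ?v n powr s * measure P (stress_set E L (u n) J)"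
      using c' by (simp add: P.emeasure_eq_measure ennreal_less_iff flip: ennreal_mult)
    then show ?case
      using elim by (simp add: powr_mult field_simps)
  qed
  then show thesis
    using that[of "c' / 2 powr s"] c' by simp
qed

end

subsection \<open>Thresholds and stress levels\<close>

text \<open>In decreasing order the entries above \<open>x\<close> form an initial segment of the
  list. The comparison with \<open>x\<close> is strict on both sides, so ties do no harm. This turns
  a statement about an order statistic into one about a count.\<close>

lemma kth_largest_greater_iff:
  assumes "1 \<le> k" "k \<le> length xs"
  shows "x < kth_largest k xs \<longleftrightarrow> k \<le> length (filter (\<lambda>y. x < y) xs)"
proof -
  let ?ys = "rev (sort xs)"
  have "mset (filter (\<lambda>y. x < y) ?ys) = mset (filter (\<lambda>y. x < y) xs)"
    by simp
  then have "length (filter (\<lambda>y. x < y) xs) = length (filter (\<lambda>y. x < y) ?ys)"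
    by (metis size_mset)
  also have "\<dots> = card {i. i < length xs \<and> x < ?ys ! i}"
    by (simp add: length_filter_conv_card)
  finally have card: "length (filter (\<lambda>y. x < y) xs) = card {i. i < length xs \<and> x < ?ys ! i}" .
  have mono: "?ys ! j \<le> ?ys ! i" if "i \<le> j" "j < length xs" for i j
    using that by (simp add: rev_nth sorted_nth_mono)
  show ?thesis
  proof
    assume "x < kth_largest k xs"
    then have "{..<k} \<subseteq> {i. i < length xs \<and> x < ?ys ! i}"
      using mono[of _ "k - 1"] assms by (fastforce simp: kth_largest_def intro: less_le_trans)
    from card_mono[OF _ this] show "k \<le> length (filter (\<lambda>y. x < y) xs)"
      by (simp add: card)
  next
    assume k: "k \<le> length (filter (\<lambda>y. x < y) xs)"
    show "x < kth_largest k xs"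
    proof (rule ccontr)
      assume *: "\<not> x < kth_largest k xs"
      have "{i. i < length xs \<and> x < ?ys ! i} \<subseteq> {..<k - 1}"
      proof safe
        fix i assume i: "i < length xs" "x < ?ys ! i"
        show "i < k - 1"
        proof (rule ccontr)
          assume "\<not> i < k - 1"
          then have "?ys ! i \<le> ?ys ! (k - 1)" using mono i by simp
          with i * show False by (simp add: kth_largest_def)
        qed
      qed
      from card_mono[OF _ this] k assms show False
        by (simp add: card)
    qed
  qed
qed

lemma threshold_greater_iff:
  assumes "1 \<le> num_exceed q n" "num_exceed q n \<le> n"
  shows "x < threshold q n (sample \<xi> n \<omega>) \<longleftrightarrow> num_exceed q n \<le> card {i \<in> {1..n}. x < norm (\<xi> i \<omega>)}"
proof -
  have "length (filter (\<lambda>y. x < y) (map norm (sample \<xi> n \<omega>)))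
      = length (filter (\<lambda>i. x < norm (\<xi> i \<omega>)) [1..<Suc n])"
    by (simp only: sample_def filter_map length_map o_def)
  also have "\<dots> = card (set (filter (\<lambda>i. x < norm (\<xi> i \<omega>)) [1..<Suc n]))"
    by (intro distinct_card[symmetric] distinct_filter distinct_upt)
  also have "set (filter (\<lambda>i. x < norm (\<xi> i \<omega>)) [1..<Suc n]) = {i \<in> {1..n}. x < norm (\<xi> i \<omega>)}"
    by auto
  finally show ?thesis
    unfolding threshold_def using assms by (subst kth_largest_greater_iff) (auto simp: sample_def)
qed

text \<open>The floor loses less than 1, which is at most the floor itself once
  \<open>n \<ge> 1\<close>; hence the factor 2.\<close>

lemma num_exceed_bounds:
  assumes "0 < q" "q < 1" "1 \<le> n"
  shows "1 \<le> num_exceed q n" "num_exceed q n \<le> n" "real (num_exceed q n) \<le> real n powr (1 - q)"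
    "real n powr (1 - q) \<le> 2 * real (num_exceed q n)"
proof -
  have n1: "1 \<le> real n powr (1 - q)" using assms by (intro ge_one_powr_ge_zero) auto
  then have eq: "real (num_exceed q n) = real_of_int \<lfloor>real n powr (1 - q)\<rfloor>"
    by (simp add: num_exceed_def)
  have "(1::int) \<le> \<lfloor>real n powr (1 - q)\<rfloor>" using n1 by simp
  then show one: "1 \<le> num_exceed q n" using eq by linarith
  show le: "real (num_exceed q n) \<le> real n powr (1 - q)"
    using eq by simp
  have "real n powr (1 - q) \<le> real n powr 1"
    using assms by (intro powr_mono) auto
  with le show "num_exceed q n \<le> n" using assms by simp
  have "real n powr (1 - q) \<le> real (num_exceed q n) + 1"
    using eq by linarith
  with one show "real n powr (1 - q) \<le> 2 * real (num_exceed q n)" by linarith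
qed

text \<open>Too few exceedances are ruled out by Markov's inequality for the exponential of minus
  the count, whose expectation factorises by independence; the divisor 2 comes from
  \<open>exp (- 1) \<le> 1 / 2\<close>. Too many are ruled out by the first moment alone, which will
  suffice because the expected count stays bounded while \<open>k\<close> grows.\<close>

lemma (in prob_space) exceedance_count_bounds:
  fixes \<xi> :: "nat \<Rightarrow> 'a \<Rightarrow> 'b::euclidean_space"
  assumes indep: "indep_vars (\<lambda>_. borel) \<xi> {1..}" and law: "\<And>i. i \<ge> 1 \<Longrightarrow> distr M borel (\<xi> i) = P"
  shows "{\<omega> \<in> space M. k \<le> card {i \<in> {1..n}. x < norm (\<xi> i \<omega>)}} \<in> events"
    and "prob {\<omega> \<in> space M. \<not> k \<le> card {i \<in> {1..n}. x < norm (\<xi> i \<omega>)}}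
      \<le> exp (real k - real n * measure P {z. x < norm z} / 2)"
    and "1 \<le> k \<Longrightarrow> prob {\<omega> \<in> space M. k \<le> card {i \<in> {1..n}. x < norm (\<xi> i \<omega>)}}
      \<le> real n * measure P {z. x < norm z} / real k"
proof -
  have [measurable]: "\<xi> i \<in> borel_measurable M" if "i \<in> {1..n}" for i
    using indep that by (auto simp: indep_vars_def)
  let ?N = "\<lambda>\<omega>. card {i \<in> {1..n}. x < norm (\<xi> i \<omega>)}"
  define I where "I i \<omega> = indicat_real {z. x < norm z} (\<xi> i \<omega>)" for i \<omega>
  have [measurable]: "I i \<in> borel_measurable M" if "i \<in> {1..n}" for i
    unfolding I_def[abs_def] using that by measurable
  define p where "p = measure P {z. x < norm z}"
  have N: "real (?N \<omega>) = (\<Sum>i\<in>{1..n}. I i \<omega>)" for \<omega>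
    by (simp add: I_def indicator_def sum.If_cases Int_def conj_commute)
  have Nmeas [measurable]: "(\<lambda>\<omega>. real (?N \<omega>)) \<in> borel_measurable M"
    unfolding N by measurable
  have set: "{\<omega> \<in> space M. k \<le> ?N \<omega>} = {\<omega> \<in> space M. real k \<le> real (?N \<omega>)}" for k
    by simp
  show "{\<omega> \<in> space M. k \<le> ?N \<omega>} \<in> events"
    unfolding set by measurable
  \<comment> \<open>The indicator takes only the values 0 and 1, so any function of it is affine in
    it. Used below with \<open>g\<close> the identity and with
    \<open>g y = exp (- y)\<close>.\<close>
  have EI: "expectation (\<lambda>\<omega>. g (I i \<omega>)) = g 1 * p + g 0 * (1 - p)" and intI: "integrable M (\<lambda>\<omega>. g (I i \<omega>))"
    if i: "i \<in> {1..n}" for i and g :: "real \<Rightarrow> real"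
  proof -
    have \<xi>: "\<xi> i \<in> borel_measurable M" using i by measurable
    interpret P: prob_space P
      using law[of i] i prob_space_distr[OF \<xi>] by simp
    have P: "P = distr M borel (\<xi> i)" using law i by simp
    have X: "{z :: 'b. x < norm z} \<in> sets borel" by measurable
    have p_eq: "p = prob {\<omega> \<in> space M. x < norm (\<xi> i \<omega>)}"
      unfolding p_def P by (subst measure_distr) (use \<xi> X in \<open>auto intro!: arg_cong[where f = prob]\<close>)
    moreover have ev: "{\<omega> \<in> space M. x < norm (\<xi> i \<omega>)} \<in> events" using i by measurable
    moreover have g: "g (I i \<omega>) = g 0 + (g 1 - g 0) * indicat_real {\<omega> \<in> space M. x < norm (\<xi> i \<omega>)} \<omega>"
      if "\<omega> \<in> space M" for \<omega>
      using that by (simp add: I_def indicator_def)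
    have int: "integrable M (\<lambda>\<omega>. g 0 + (g 1 - g 0) * indicat_real {\<omega> \<in> space M. x < norm (\<xi> i \<omega>)} \<omega>)"
      using ev by (auto intro!: integrable_real_indicator simp: emeasure_eq_measure)
    ultimately show "integrable M (\<lambda>\<omega>. g (I i \<omega>))"
      by (subst Bochner_Integration.integrable_cong[OF refl g]) auto
    have "expectation (\<lambda>\<omega>. g (I i \<omega>))
        = expectation (\<lambda>\<omega>. g 0 + (g 1 - g 0) * indicat_real {\<omega> \<in> space M. x < norm (\<xi> i \<omega>)} \<omega>)"
      by (intro Bochner_Integration.integral_cong refl g)
    also have "\<dots> = g 0 + (g 1 - g 0) * prob {\<omega> \<in> space M. x < norm (\<xi> i \<omega>)}"
      using ev by (subst Bochner_Integration.integral_add)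
        (auto intro!: integrable_real_indicator simp: prob_space emeasure_eq_measure)
    finally show "expectation (\<lambda>\<omega>. g (I i \<omega>)) = g 1 * p + g 0 * (1 - p)"
      using p_eq by (simp add: algebra_simps)
  qed
  have p: "0 \<le> p" by (simp add: p_def)
  show "prob {\<omega> \<in> space M. \<not> k \<le> ?N \<omega>} \<le> exp (real k - real n * measure P {z. x < norm z} / 2)"
  proof -
    have indI: "indep_vars (\<lambda>_. borel) (\<lambda>i \<omega>. exp (- I i \<omega>)) {1..n}"
      unfolding I_def by (rule indep_vars_compose2[OF indep_vars_subset[OF indep]]) auto
    have prod: "exp (- real (?N \<omega>)) = (\<Prod>i\<in>{1..n}. exp (- I i \<omega>))" for \<omega>
      unfolding N by (simp add: exp_sum flip: sum_negf)
    have int: "integrable M (\<lambda>\<omega>. exp (- real (?N \<omega>)))"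
      unfolding prod using indI intI[of _ "\<lambda>y. exp (- y)"] by (intro indep_vars_integrable) auto
    have "expectation (\<lambda>\<omega>. exp (- real (?N \<omega>))) = (\<Prod>i\<in>{1..n}. expectation (\<lambda>\<omega>. exp (- I i \<omega>)))"
      unfolding prod using indI intI[of _ "\<lambda>y. exp (- y)"] by (intro indep_vars_lebesgue_integral) auto
    also have "\<dots> = (\<Prod>i\<in>{1..n}. exp (- 1) * p + (1 - p))"
      by (intro prod.cong refl, subst EI[of _ "\<lambda>y. exp (- y)"]) auto
    also have "\<dots> \<le> (\<Prod>i\<in>{1..n}. exp (- p / 2))"
    proof (intro prod_mono conjI)
      have "exp (- 1 :: real) \<le> 1 / 2"
        using exp_ge_add_one_self[of 1] by (simp add: exp_minus field_simps)
      then have "exp (- 1) * p \<le> 1 / 2 * p"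
        using p by (intro mult_right_mono) auto
      then have "exp (- 1) * p + (1 - p) \<le> 1 + (- p / 2)" by simp
      also have "\<dots> \<le> exp (- p / 2)" by (rule exp_ge_add_one_self)
      finally show "exp (- 1) * p + (1 - p) \<le> exp (- p / 2)" .
      show "0 \<le> exp (- 1) * p + (1 - p)" if "i \<in> {1..n}" for i
        unfolding EI[OF that, of "\<lambda>y. exp (- y)", simplified, symmetric] by simp
    qed
    also have "\<dots> = exp (- (real n * p / 2))"
      by (simp flip: exp_of_nat_mult)
    finally have E: "expectation (\<lambda>\<omega>. exp (- real (?N \<omega>))) \<le> exp (- (real n * p / 2))" .
    have "prob {\<omega> \<in> space M. \<not> k \<le> ?N \<omega>} \<le> prob {\<omega> \<in> space M. exp (- real k) \<le> exp (- real (?N \<omega>))}"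
      by (intro finite_measure_mono) auto
    also have "\<dots> \<le> expectation (\<lambda>\<omega>. exp (- real (?N \<omega>))) / exp (- real k)"
      using int by (intro integral_Markov_inequality_measure[where A = "space M"]) auto
    also have "\<dots> \<le> exp (- (real n * p / 2)) / exp (- real k)"
      using E by (intro divide_right_mono) auto
    also have "\<dots> = exp (real k - real n * p / 2)"
      by (simp flip: exp_diff)
    finally show ?thesis by (simp add: p_def)
  qed
  show "prob {\<omega> \<in> space M. k \<le> ?N \<omega>} \<le> real n * measure P {z. x < norm z} / real k" if "1 \<le> k"
  proof -
    have int: "integrable M (\<lambda>\<omega>. real (?N \<omega>))"
      unfolding N using intI[of _ "\<lambda>y. y"] by auto
    have "prob {\<omega> \<in> space M. real k \<le> real (?N \<omega>)} \<le> expectation (\<lambda>\<omega>. real (?N \<omega>)) / real k"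
      using int that by (intro integral_Markov_inequality_measure[where A = "space M"]) auto
    also have "expectation (\<lambda>\<omega>. real (?N \<omega>)) = real n * p"
      unfolding N using intI[of _ "\<lambda>y. y"] EI[of _ "\<lambda>y. y"] by simp
    finally show ?thesis by (simp add: set p_def)
  qed
qed

section \<open>Tail of the norm and its extreme quantiles\<close>

context regularly_varying_model
begin

text \<open>The case \<open>B = UNIV\<close> of \<open>tail_compare\<close>, once the second-order
  error has dropped below half of \<open>angular_mass\<close>: the rescaled tail then lies between
  half and, generously, twice that mass.\<close>

lemma tail_bounds:
  obtains a b T where "0 < a" "0 < b" "0 < T"
    "\<And>t. T \<le> t \<Longrightarrow> a * t powr (- s) \<le> measure P {x. t < norm x}"
    "\<And>t. T \<le> t \<Longrightarrow> measure P {x. t < norm x} \<le> b * t powr (- s)"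
proof -
  obtain C T where CT: "T > 0" "\<And>t B. \<lbrakk>T \<le> t; B \<in> sets borel\<rbrakk>
      \<Longrightarrow> \<bar>s * t powr s * measure P {x. norm x > t \<and> sgn x \<in> B} - measure limit_measure B\<bar> \<le> C * t powr (- \<gamma>)"
    using tail_compare by metis
  have "((\<lambda>t. C * t powr (- \<gamma>)) \<longlongrightarrow> C * 0) at_top"
    using \<gamma>_pos by (intro tendsto_mult_left tendsto_neg_powr filterlim_ident) auto
  then have "eventually (\<lambda>t. C * t powr (- \<gamma>) < angular_mass / 2) at_top"
    using angular_mass_pos by (intro order_tendstoD) auto
  then obtain T' where T': "\<And>t. T' \<le> t \<Longrightarrow> C * t powr (- \<gamma>) < angular_mass / 2"
    by (auto simp: eventually_at_top_linorder)
  have bounds: "angular_mass / 2 \<le> s * t powr s * measure P {x. t < norm x}"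
    "s * t powr s * measure P {x. t < norm x} \<le> 2 * angular_mass" if "max T T' \<le> t" for t
  proof -
    have "\<bar>s * t powr s * measure P {x. t < norm x} - angular_mass\<bar> \<le> angular_mass / 2"
      using CT(2)[of t UNIV] T'[of t] that by (simp add: angular_mass_def)
    then show "angular_mass / 2 \<le> s * t powr s * measure P {x. t < norm x}"
      "s * t powr s * measure P {x. t < norm x} \<le> 2 * angular_mass"
      using angular_mass_pos by linarith+
  qed
  show thesis
  proof (rule that[of "angular_mass / (2 * s)" "2 * angular_mass / s" "max T T'"])
    fix t assume t: "max T T' \<le> t"
    then have "t > 0" using CT(1) by simp
    then show "angular_mass / (2 * s) * t powr (- s) \<le> measure P {x. t < norm x}"
      "measure P {x. t < norm x} \<le> 2 * angular_mass / s * t powr (- s)"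
      using bounds[OF t] s_pos by (simp_all add: powr_minus field_simps)
  qed (use CT angular_mass_pos s_pos in auto)
qed

lemma cdf_norm: "cdf (distr P borel norm) x = 1 - measure P {z. x < norm z}"
proof -
  interpret P: prob_space P by (rule prob_space_P)
  have "cdf (distr P borel norm) x = measure P (space P - {z. x < norm z})"
    unfolding cdf_def by (subst measure_distr) (auto intro!: arg_cong[where f = "measure P"])
  also have "\<dots> = 1 - measure P {z. x < norm z}"
    by (rule P.prob_compl) simp
  finally show ?thesis .
qed

text \<open>The tail of the norm is positive at every level, so \<open>n powr (- r)\<close>
  eventually drops below it and pushes the quantile past that level. That the quantile itself
  satisfies its defining inequality is right continuity of the distribution function. At
  \<open>n = 1\<close> the infimum would run over all reals, hence \<open>2 \<le> n\<close>.\<close>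

lemma stress_level_properties:
  assumes "r > 0"
  shows "filterlim (stress_level P r) at_top sequentially"
    and "2 \<le> n \<Longrightarrow> measure P {x. stress_level P r n < norm x} \<le> real n powr (- r)"
proof -
  interpret P: prob_space P by (rule prob_space_P)
  interpret D: real_distribution "distr P borel norm"
    by (rule P.real_distribution_distr) simp
  obtain a b T where ab: "0 < a" "0 < b" "0 < T"
    "\<And>t. T \<le> t \<Longrightarrow> a * t powr (- s) \<le> measure P {x. t < norm x}"
    "\<And>t. T \<le> t \<Longrightarrow> measure P {x. t < norm x} \<le> b * t powr (- s)"
    using tail_bounds by blast
  define X where "X n = {x. measure P {z. x < norm z} \<le> real n powr (- r)}" for n :: nat
  have level: "stress_level P r n = Inf (X n)" for n
    by (simp add: stress_level_def quantile_def cdf_norm X_def)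
  have mono: "measure P {z. y < norm z} \<le> measure P {z. x < norm z}" if "x \<le> y" for x y
    using that by (intro P.finite_measure_mono) auto
  have nonempty: "X n \<noteq> {}" if "2 \<le> n" for n
  proof -
    have "((\<lambda>t. b * t powr (- s)) \<longlongrightarrow> b * 0) at_top"
      using s_pos by (intro tendsto_mult_left tendsto_neg_powr filterlim_ident) auto
    then have "eventually (\<lambda>t. b * t powr (- s) < real n powr (- r)) at_top"
      using that by (intro order_tendstoD) auto
    then obtain t where "t \<ge> T" "b * t powr (- s) < real n powr (- r)"
      using eventually_happens[OF eventually_conj[OF eventually_ge_at_top[of T]]] by auto
    then have "t \<in> X n" using ab(5)[of t] by (simp add: X_def)
    then show ?thesis by auto
  qed
  have bdd: "bdd_below (X n)" if "2 \<le> n" for n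
  proof (rule bdd_belowI[of _ 0], rule ccontr)
    fix x assume "x \<in> X n" "\<not> 0 \<le> x"
    then have "{z :: 'a. x < norm z} = UNIV"
      by (auto intro: less_le_trans[OF _ norm_ge_zero])
    with \<open>x \<in> X n\<close> have "1 \<le> real n powr (- r)"
      using P.prob_space by (simp add: X_def)
    moreover have "real n powr (- r) < 1"
      using that \<open>r > 0\<close> by (simp add: powr_less_one)
    ultimately show False by simp
  qed
  show "filterlim (stress_level P r) at_top sequentially"
    unfolding filterlim_at_top
  proof
    fix Z :: real
    let ?Z = "max Z T"
    have "0 < a * ?Z powr (- s)" using ab by auto
    also have "\<dots> \<le> measure P {z. ?Z < norm z}" by (rule ab(4)) simp
    finally have pos: "0 < measure P {z. ?Z < norm z}" .
    have "((\<lambda>n. real n powr (- r)) \<longlonglongrightarrow> 0)"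
      using \<open>r > 0\<close> by (intro tendsto_neg_powr filterlim_real_sequentially) auto
    then have "eventually (\<lambda>n. real n powr (- r) < measure P {z. ?Z < norm z}) sequentially"
      using pos by (rule order_tendstoD)
    then show "eventually (\<lambda>n. Z \<le> stress_level P r n) sequentially"
      using eventually_ge_at_top[of 2]
    proof eventually_elim
      case (elim n)
      have "?Z \<le> Inf (X n)"
      proof (rule cInf_greatest[OF nonempty[OF elim(2)]], rule ccontr)
        fix x assume "x \<in> X n" "\<not> ?Z \<le> x"
        with mono[of x ?Z] elim(1) show False by (simp add: X_def)
      qed
      then show ?case by (simp add: level)
    qed
  qed
  show "measure P {x. stress_level P r n < norm x} \<le> real n powr (- r)" if n: "2 \<le> n"
  proof -
    let ?u = "stress_level P r n"
    have "(cdf (distr P borel norm) \<longlongrightarrow> cdf (distr P borel norm) ?u) (at_right ?u)"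
      using D.cdf_is_right_cont[of ?u] by (simp add: continuous_within)
    moreover have "eventually (\<lambda>x. 1 - real n powr (- r) \<le> cdf (distr P borel norm) x) (at_right ?u)"
    proof -
      have "1 - real n powr (- r) \<le> cdf (distr P borel norm) x" if xu: "?u < x" for x
      proof -
        obtain y where "y \<in> X n" "y < x"
          using xu[unfolded level cInf_less_iff[OF nonempty[OF n] bdd[OF n]]] by blast
        with mono[of y x] show ?thesis by (simp add: X_def cdf_norm)
      qed
      then show ?thesis by (auto intro: eventually_at_rightI[of _ "?u + 1"])
    qed
    ultimately have "1 - real n powr (- r) \<le> cdf (distr P borel norm) ?u"
      by (intro tendsto_lowerbound) auto
    then show ?thesis by (simp add: cdf_norm)
  qed
qed

end

subsection \<open>Rate of convergence\<close>

lemma (in prob_space) prob_Int_ge: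
  assumes "A \<in> events" "B \<in> events" "prob A \<ge> 1 - a" "prob B \<ge> 1 - b"
  shows "prob (A \<inter> B) \<ge> 1 - (a + b)"
proof -
  have "prob (A \<union> B) \<le> 1" by simp
  moreover have "prob (A \<union> B) = prob A + prob B - prob (A \<inter> B)"
    using assms by (intro measure_Un3) (auto simp: fmeasurable_eq_sets)
  ultimately show ?thesis using assms by linarith
qed

text \<open>\<open>bigO_P\<close> asks for measurable events, so almost-sure hypotheses are turned
  into an event of probability 1.\<close>

lemma (in prob_space) AE_obtain_event:
  assumes "AE \<omega> in M. R \<omega>"
  obtains A where "A \<in> events" "prob A = 1" "\<And>\<omega>. \<omega> \<in> A \<Longrightarrow> R \<omega>"
proof -
  from assms obtain N where N: "{\<omega> \<in> space M. \<not> R \<omega>} \<subseteq> N" "emeasure M N = 0" "N \<in> events"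
    by (rule AE_E)
  show thesis
  proof (rule that[of "space M - N"])
    have "prob N = 0" using N(2) by (simp add: measure_def)
    then show "prob (space M - N) = 1"
      using prob_compl[OF N(3)] by linarith
    show "R \<omega>" if "\<omega> \<in> space M - N" for \<omega>
      using that N(1) by blast
  qed (use N in auto)
qed

section \<open>Distance of the stressed laws, and the random threshold\<close>

context regularly_varying_model
begin

lemma prob_space_angular_law:
  assumes "0 < measure P {x. t < norm x}"
  shows "prob_space (angular_law P t)"
proof -
  interpret P: prob_space P by (rule prob_space_P)
  have "prob_space (uniform_measure P {x. t < norm x})"
    using assms by (intro prob_space_uniform_measure) (auto simp: P.emeasure_eq_measure)
  moreover have "sgn \<in> measurable (uniform_measure P {x. t < norm x}) borel"
    by (simp cong: measurable_cong_sets)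
  ultimately show ?thesis
    unfolding angular_law_def by (rule prob_space.prob_space_distr)
qed

lemma measure_angular_law:
  assumes "0 < measure P {x. t < norm x}" and [measurable]: "B \<in> sets borel"
  shows "measure (angular_law P t) B = measure P {x. t < norm x \<and> sgn x \<in> B} / measure P {x. t < norm x}"
proof -
  interpret P: prob_space P by (rule prob_space_P)
  have "sgn \<in> measurable (uniform_measure P {x. t < norm x}) borel"
    by (simp cong: measurable_cong_sets)
  then have "measure (angular_law P t) B = measure (uniform_measure P {x. t < norm x}) {x. sgn x \<in> B}"
    unfolding angular_law_def by (subst measure_distr) (auto simp: vimage_def)
  also have "\<dots> = measure P ({x. t < norm x} \<inter> {x. sgn x \<in> B}) / measure P {x. t < norm x}"
    using assms by (intro measure_uniform_measure) (auto simp: P.emeasure_eq_measure)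
  finally show ?thesis by (simp add: Collect_conj_eq)
qed

text \<open>The abstract error \<open>\<epsilon>\<close> of \<open>tail_compare\<close> becomes the
  estimation error of the angular law at \<open>t\<close> plus the distance of that law from the
  limit. The denominator stays explicit, to be bounded below by \<open>stress_set_mass\<close> when
  \<open>v\<close> is a multiple of the stress level.\<close>

lemma stressed_law_distance:
  obtains C T where "C \<ge> 0" "T > 0"
    "\<And>v t p s' \<psi> Q S D D' u. \<lbrakk>T \<le> t; t \<le> v; 0 < p; 0 < s'; \<psi> \<in> borel_measurable borel;
      prob_space (density \<sigma> \<psi>); ssgen_law E t p s' \<psi> Q; S \<in> sets borel; S \<subseteq> {x. norm x > v};
      0 < measure P S; prob_space D; sets D = sets borel; prob_space D'; sets D' = sets borel\<rbrakk>
      \<Longrightarrow> total_variation (stressed_law D' Q u S) (stressed_law D P u S)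
        \<le> C * (t powr (- \<gamma>) + total_variation (angular_law P t) (density \<sigma> \<psi>) + \<bar>s' - s\<bar> / s')
          / (v powr s * measure P S)"
    "\<And>t. T \<le> t \<Longrightarrow> prob_space (angular_law P t)"
proof -
  obtain a T0 where T0: "0 < a" "0 < T0" "\<And>t. T0 \<le> t \<Longrightarrow> a * t powr (- s) \<le> measure P {x. t < norm x}"
    using tail_bounds by metis
  obtain C T1 where C: "C \<ge> 0" "T1 > 0"
    and compare: "\<And>v t p s' \<psi> Q A \<epsilon>. \<lbrakk>T1 \<le> v; 0 < t; t \<le> v; 0 < p; 0 < s'; \<psi> \<in> borel_measurable borel;
      prob_space (density \<sigma> \<psi>); ssgen_law E t p s' \<psi> Q; A \<in> sets borel; A \<subseteq> {x. norm x > v};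
      \<And>B. B \<in> sets borel \<Longrightarrow> \<bar>measure limit_measure B - angular_mass * measure (density \<sigma> \<psi>) B\<bar> \<le> \<epsilon>\<rbrakk>
      \<Longrightarrow> \<bar>v powr s * measure P A - angular_mass * (v powr s' / (p * s' * t powr s')) * measure Q A\<bar>
        \<le> (C * v powr (- \<gamma>) + \<epsilon>) / s + angular_mass * \<bar>1 / s - 1 / s'\<bar>"
    and angular: "\<And>t B. \<lbrakk>T1 \<le> t; B \<in> sets borel\<rbrakk>
      \<Longrightarrow> \<bar>s * t powr s * measure P {x. norm x > t \<and> sgn x \<in> B} - measure limit_measure B\<bar> \<le> C * t powr (- \<gamma>)"
    using tail_compare by blast
  define T where "T = max T0 T1"
  have pos: "0 < measure P {x. t < norm x}" if "T \<le> t" for t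
  proof -
    have "0 < a * t powr (- s)" using that T0 by (simp add: T_def)
    then show ?thesis using T0(3)[of t] that by (simp add: T_def)
  qed
  have prob: "prob_space (angular_law P t)" if "T \<le> t" for t
    using pos[OF that] by (rule prob_space_angular_law)
  \<comment> \<open>The angular law at \<open>t\<close> is a quotient of two rescaled tail masses,
    each within \<open>C * t powr (- \<gamma>)\<close> of its limit; clearing the denominator gives
    twice that error.\<close>
  have angular': "\<bar>measure limit_measure B - angular_mass * measure (angular_law P t) B\<bar> \<le> 2 * C * t powr (- \<gamma>)"
    if t: "T \<le> t" and B: "B \<in> sets borel" for t B
  proof -
    interpret prob_space "angular_law P t" by (rule prob) fact
    define w where "w = s * t powr s"
    have "w > 0" using t T0 s_pos by (simp add: w_def T_def)
    let ?X = "w * measure P {x. norm x > t \<and> sgn x \<in> B}" and ?Y = "w * measure P {x. t < norm x}"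
    have X: "\<bar>?X - measure limit_measure B\<bar> \<le> C * t powr (- \<gamma>)"
      using angular[of t B] t B by (simp add: w_def T_def)
    have Y: "\<bar>?Y - angular_mass\<bar> \<le> C * t powr (- \<gamma>)"
      using angular[of t UNIV] t by (simp add: w_def T_def angular_mass_def)
    have "?X = ?Y * prob B"
      using pos[OF t] by (simp add: measure_angular_law B)
    then have "measure limit_measure B - angular_mass * prob B
        = (measure limit_measure B - ?X) + (?Y - angular_mass) * prob B"
      by (simp add: algebra_simps)
    moreover have "\<bar>(?Y - angular_mass) * prob B\<bar> \<le> \<bar>?Y - angular_mass\<bar>"
      by (simp add: abs_mult mult_left_le)
    ultimately show ?thesis using X Y by linarith
  qed
  \<comment> \<open>The 2 comes from the quotient bound, the 3 from one error \<open>C\<close> at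
    \<open>v\<close> and two at \<open>t\<close>; a common coefficient serves all three
    terms.\<close>
  define C' where "C' = 2 * (3 * C + angular_mass) / s"
  show thesis
  proof (rule that[of C' T])
    show "C' \<ge> 0" using C angular_mass_pos s_pos by (simp add: C'_def)
    show "T > 0" using T0 by (simp add: T_def)
    show "\<And>t. T \<le> t \<Longrightarrow> prob_space (angular_law P t)" by (rule prob)
    fix v t p s' u and \<psi> :: "'a \<Rightarrow> real" and Q D D' :: "'a measure" and S :: "'a set"
    assume t: "T \<le> t" "t \<le> v" and p: "0 < p" "0 < s'" and \<psi>: "\<psi> \<in> borel_measurable borel"
      and prob_\<psi>: "prob_space (density \<sigma> \<psi>)" and gen: "ssgen_law E t p s' \<psi> Q"
      and S: "S \<in> sets borel" "S \<subseteq> {x. norm x > v}" "0 < measure P S"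
      and D: "prob_space D" "sets D = sets borel" "prob_space D'" "sets D' = sets borel"
    let ?TV = "total_variation (angular_law P t) (density \<sigma> \<psi>)"
    define \<epsilon> where "\<epsilon> = 2 * C * t powr (- \<gamma>) + angular_mass * ?TV"
    define \<delta> where "\<delta> = (C * v powr (- \<gamma>) + \<epsilon>) / s + angular_mass * \<bar>1 / s - 1 / s'\<bar>"
    have t0: "0 < t" "T1 \<le> v" using t T0 by (auto simp: T_def)
    have \<epsilon>: "\<bar>measure limit_measure B - angular_mass * measure (density \<sigma> \<psi>) B\<bar> \<le> \<epsilon>"
      if B: "B \<in> sets borel" for B
    proof -
      have "\<bar>measure (angular_law P t) B - measure (density \<sigma> \<psi>) B\<bar> \<le> ?TV"
        by (rule total_variation_bounds[OF prob[OF t(1)] prob_\<psi>]) (simp add: angular_law_def B)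
      then have "\<bar>angular_mass * (measure (angular_law P t) B - measure (density \<sigma> \<psi>) B)\<bar> \<le> angular_mass * ?TV"
        using angular_mass_pos by (simp add: abs_mult)
      then show ?thesis
        using angular'[OF t(1) B] unfolding \<epsilon>_def right_diff_distrib by linarith
    qed
    have "total_variation (stressed_law D' Q u S) (stressed_law D P u S) \<le> 2 * \<delta> / (v powr s * measure P S)"
    proof (rule total_variation_stressed_law_le)
      show "prob_space Q" "sets Q = sets borel" using gen by (auto simp: ssgen_law_def)
      show "0 < angular_mass * (v powr s' / (p * s' * t powr s'))"
        using p t t0 angular_mass_pos by auto
      show "0 < v powr s" using t t0 by auto
      fix A assume "A \<in> sets borel" "A \<subseteq> S"
      then show "\<bar>v powr s * measure P A - angular_mass * (v powr s' / (p * s' * t powr s')) * measure Q A\<bar> \<le> \<delta>"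
        unfolding \<delta>_def using S t t0 p by (intro compare[OF _ _ _ _ _ \<psi> prob_\<psi> gen] \<epsilon>) auto
    qed (use D S prob_space_P in auto)
    also have "2 * \<delta> \<le> C' * (t powr (- \<gamma>) + ?TV + \<bar>s' - s\<bar> / s')"
    proof -
      have "v powr (- \<gamma>) \<le> t powr (- \<gamma>)"
        using t t0 \<gamma>_pos by (intro powr_mono2') auto
      then have *: "C * v powr (- \<gamma>) \<le> C * t powr (- \<gamma>)"
        using C by (intro mult_left_mono)
      have TV: "0 \<le> ?TV" by (rule total_variation_nonneg[OF prob[OF t(1)] prob_\<psi>])
      have "1 / s - 1 / s' = (s' - s) / s' / s"
        using p s_pos by (simp add: field_simps)
      then have eq: "\<bar>1 / s - 1 / s'\<bar> = \<bar>s' - s\<bar> / s' / s"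
        using p s_pos by (simp add: abs_divide)
      have "s * \<delta> = C * v powr (- \<gamma>) + \<epsilon> + angular_mass * (\<bar>s' - s\<bar> / s')"
        unfolding \<delta>_def eq using s_pos by (simp add: field_simps)
      also have "\<dots> \<le> 3 * C * t powr (- \<gamma>) + angular_mass * ?TV + angular_mass * (\<bar>s' - s\<bar> / s')"
        unfolding \<epsilon>_def using * by linarith
      also have "\<dots> \<le> (3 * C + angular_mass) * t powr (- \<gamma>) + (3 * C + angular_mass) * ?TV
          + (3 * C + angular_mass) * (\<bar>s' - s\<bar> / s')"
        using C angular_mass_pos TV p by (intro add_mono mult_right_mono) auto
      also have "\<dots> = (3 * C + angular_mass) * (t powr (- \<gamma>) + ?TV + \<bar>s' - s\<bar> / s')"
        by (simp only: distrib_left)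
      finally have "2 * (s * \<delta>) / s \<le> 2 * ((3 * C + angular_mass) * (t powr (- \<gamma>) + ?TV + \<bar>s' - s\<bar> / s')) / s"
        using s_pos by (intro divide_right_mono mult_left_mono) auto
      then show ?thesis
        using s_pos by (simp only: C'_def mult.assoc times_divide_eq_left) simp
    qed
    finally show "total_variation (stressed_law D' Q u S) (stressed_law D P u S)
        \<le> C' * (t powr (- \<gamma>) + ?TV + \<bar>s' - s\<bar> / s') / (v powr s * measure P S)"
      using t t0 S by (simp add: divide_right_mono)
  qed
qed

text \<open>The threshold exceeds a level exactly when at least \<open>num_exceed q n\<close>
  observations do, so both sides are counting bounds. The constant \<open>b\<close> is uniform in
  \<open>\<epsilon>\<close>, because both failure probabilities tend to 0.\<close>

lemma threshold_in_probability:
  assumes M: "prob_space M" and indep: "prob_space.indep_vars M (\<lambda>_. borel) \<xi> {1..}"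
    and law: "\<And>i. i \<ge> 1 \<Longrightarrow> distr M borel (\<xi> i) = P"
    and q: "0 < q" "q < 1" and "r \<ge> 1" "c > 0"
  obtains b where "b > 0"
    "\<And>\<epsilon>. \<epsilon> > 0 \<Longrightarrow> \<forall>\<^sub>F n in sequentially. \<exists>A\<in>sets M. measure M A \<ge> 1 - \<epsilon> \<and>
      (\<forall>\<omega>\<in>A. b * real n powr (q / s) \<le> threshold q n (sample \<xi> n \<omega>) \<and>
        threshold q n (sample \<xi> n \<omega>) \<le> c * stress_level P r n)"
proof -
  interpret M: prob_space M by (rule M)
  obtain a b T where ab: "0 < a" "0 < b" "0 < T"
    "\<And>t. T \<le> t \<Longrightarrow> a * t powr (- s) \<le> measure P {x. t < norm x}"
    "\<And>t. T \<le> t \<Longrightarrow> measure P {x. t < norm x} \<le> b * t powr (- s)"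
    using tail_bounds by blast
  \<comment> \<open>Chosen so that \<open>a * \<beta> powr (- s) = 4\<close>: the expected count at
    the lower level is then at least \<open>4 * n powr (1 - q)\<close>, and the exponential bound
    has exponent at most \<open>n powr (1 - q) - 2 * n powr (1 - q)\<close>.\<close>
  define \<beta> where "\<beta> = (a / 4) powr (1 / s)"
  have "\<beta> > 0" using ab by (simp add: \<beta>_def)
  let ?u = "stress_level P r"
  \<comment> \<open>Bounds the ratio of the tail at \<open>c * ?u n\<close> to the tail at
    \<open>?u n\<close>, and with \<open>r \<ge> 1\<close> the expected number of observations
    beyond \<open>c * ?u n\<close>.\<close>
  define B where "B = b * c powr (- s) / a"
  have "B > 0" using ab \<open>c > 0\<close> by (simp add: B_def)
  note u_props = stress_level_properties[of r]
  show thesis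
  proof (rule that[OF \<open>\<beta> > 0\<close>])
    fix \<epsilon> :: real assume "\<epsilon> > 0"
    have "(\<lambda>n. exp (- (real n powr (1 - q)))) \<longlonglongrightarrow> 0"
      using q by real_asymp
    then have ev1: "eventually (\<lambda>n. exp (- (real n powr (1 - q))) < \<epsilon> / 2) sequentially"
      using \<open>\<epsilon> > 0\<close> by (intro order_tendstoD) auto
    have "(\<lambda>n. B * 2 * real n powr (- (1 - q))) \<longlonglongrightarrow> 0"
      using q by real_asymp
    then have ev2: "eventually (\<lambda>n. B * 2 * real n powr (- (1 - q)) < \<epsilon> / 2) sequentially"
      using \<open>\<epsilon> > 0\<close> by (intro order_tendstoD) auto
    have "filterlim (\<lambda>n. \<beta> * real n powr (q / s)) at_top sequentially"
      using q s_pos \<open>\<beta> > 0\<close> by real_asymp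
    then have ev3: "eventually (\<lambda>n. T \<le> \<beta> * real n powr (q / s)) sequentially"
      by (simp add: filterlim_at_top)
    have "filterlim ?u at_top sequentially"
      using \<open>r \<ge> 1\<close> by (intro u_props(1)) simp
    then have "eventually (\<lambda>n. max T (T / c) \<le> ?u n) sequentially"
      unfolding filterlim_at_top by blast
    from ev1 ev2 ev3 this eventually_ge_at_top[of 2]
    show "\<forall>\<^sub>F n in sequentially. \<exists>A\<in>sets M. measure M A \<ge> 1 - \<epsilon> \<and>
      (\<forall>\<omega>\<in>A. \<beta> * real n powr (q / s) \<le> threshold q n (sample \<xi> n \<omega>) \<and>
        threshold q n (sample \<xi> n \<omega>) \<le> c * ?u n)"
    proof eventually_elim
      case (elim n)
      let ?k = "num_exceed q n" and ?x = "\<beta> * real n powr (q / s)"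
      note k = num_exceed_bounds[OF q, of n]
      have n: "1 \<le> n" "0 < real n" using elim by auto
      have kn: "1 \<le> ?k" "?k \<le> n" using k n by auto
      have iff: "x < threshold q n (sample \<xi> n \<omega>) \<longleftrightarrow> ?k \<le> card {i \<in> {1..n}. x < norm (\<xi> i \<omega>)}" for x \<omega>
        using kn by (rule threshold_greater_iff)
      note count = M.exceedance_count_bounds[OF indep law]
      define A where "A x = {\<omega> \<in> space M. ?k \<le> card {i \<in> {1..n}. x < norm (\<xi> i \<omega>)}}" for x
      have A: "A x \<in> sets M" for x
        unfolding A_def by (rule count(1))
      have "M.prob (space M - A ?x) \<le> \<epsilon> / 2"
      proof -
        have "?x powr (- s) = \<beta> powr (- s) * real n powr (- q)"
          using \<open>\<beta> > 0\<close> s_pos by (simp add: powr_mult powr_powr)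
        also have "\<beta> powr (- s) = 4 / a"
          using ab s_pos by (simp add: \<beta>_def powr_powr powr_minus_divide)
        finally have "4 * real n powr (- q) = a * ?x powr (- s)"
          using ab by simp
        also have "\<dots> \<le> measure P {x. ?x < norm x}"
          using elim by (intro ab(4))
        finally have "real n * (4 * real n powr (- q)) \<le> real n * measure P {x. ?x < norm x}"
          by (intro mult_left_mono) auto
        moreover have "real n * real n powr (- q) = real n powr (1 - q)"
          using n by (simp add: powr_diff powr_minus divide_inverse)
        ultimately have np: "4 * real n powr (1 - q) \<le> real n * measure P {x. ?x < norm x}"
          by simp
        have "space M - A ?x = {\<omega> \<in> space M. \<not> ?k \<le> card {i \<in> {1..n}. ?x < norm (\<xi> i \<omega>)}}"
          by (auto simp: A_def)
        then have "M.prob (space M - A ?x) \<le> exp (real ?k - real n * measure P {x. ?x < norm x} / 2)"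
          using count(2) by simp
        also have "\<dots> \<le> exp (- (real n powr (1 - q)))"
          using np k(3) n by simp
        also have "\<dots> \<le> \<epsilon> / 2" using elim by simp
        finally show ?thesis .
      qed
      then have "M.prob (A ?x) \<ge> 1 - \<epsilon> / 2"
        using A by (simp add: M.prob_compl)
      moreover have "M.prob (A (c * ?u n)) \<le> \<epsilon> / 2"
      proof -
        have u: "T \<le> ?u n" "T \<le> c * ?u n" "0 < ?u n"
          using elim \<open>c > 0\<close> ab by (auto simp: field_simps)
        have "measure P {x. c * ?u n < norm x} \<le> b * (c * ?u n) powr (- s)"
          using u by (intro ab(5))
        also have "\<dots> = B * (a * ?u n powr (- s))"
          using ab \<open>c > 0\<close> u by (simp add: B_def powr_mult)
        also have "\<dots> \<le> B * measure P {x. ?u n < norm x}"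
          using \<open>B > 0\<close> u by (intro mult_left_mono ab(4)) auto
        also have "\<dots> \<le> B * real n powr (- r)"
          using \<open>B > 0\<close> \<open>r \<ge> 1\<close> elim by (intro mult_left_mono u_props(2)) auto
        also have "\<dots> \<le> B * real n powr (- 1)"
          using \<open>B > 0\<close> \<open>r \<ge> 1\<close> n by (intro mult_left_mono powr_mono) auto
        finally have "real n * measure P {x. c * ?u n < norm x} \<le> real n * (B * real n powr (- 1))"
          by (intro mult_left_mono) auto
        also have "\<dots> = B" using n by (simp add: powr_minus)
        finally have np: "real n * measure P {x. c * ?u n < norm x} \<le> B" .
        have "M.prob (A (c * ?u n)) \<le> real n * measure P {x. c * ?u n < norm x} / real ?k"
          unfolding A_def by (intro count(3)) (use kn in auto)
        also have "\<dots> \<le> B / real ?k"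
          using np by (intro divide_right_mono) auto
        also have "\<dots> \<le> B / (real n powr (1 - q) / 2)"
          using k(4) n kn \<open>B > 0\<close> by (intro divide_left_mono) auto
        also have "\<dots> = B * 2 * real n powr (- (1 - q))"
          unfolding powr_minus by (simp add: field_simps)
        also have "\<dots> \<le> \<epsilon> / 2" using elim by simp
        finally show ?thesis .
      qed
      then have "M.prob (space M - A (c * ?u n)) \<ge> 1 - \<epsilon> / 2"
        using A by (simp add: M.prob_compl)
      ultimately have "M.prob (A ?x \<inter> (space M - A (c * ?u n))) \<ge> 1 - (\<epsilon> / 2 + \<epsilon> / 2)"
        using A by (intro M.prob_Int_ge) auto
      then have "M.prob (A ?x \<inter> (space M - A (c * ?u n))) \<ge> 1 - \<epsilon>"
        by simp
      moreover have "?x \<le> threshold q n (sample \<xi> n \<omega>) \<and> threshold q n (sample \<xi> n \<omega>) \<le> c * ?u n"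
        if "\<omega> \<in> A ?x \<inter> (space M - A (c * ?u n))" for \<omega>
        using that iff[of ?x \<omega>] iff[of "c * ?u n" \<omega>] unfolding A_def not_less[symmetric]
        by (blast intro: less_asym)
      ultimately show ?case
        using A by (intro bexI[of _ "A ?x \<inter> (space M - A (c * ?u n))"] conjI ballI) blast+
    qed
  qed
qed

end

theorem corollary2:
  fixes M :: "'w measure"
    and \<xi> :: "nat \<Rightarrow> 'w \<Rightarrow> 'a::euclidean_space"
    and E :: "'a set" and P :: "'a measure"
    and f phi_star :: "'a \<Rightarrow> real" and s \<gamma> :: real
    and K :: nat and L Lstar :: "nat \<Rightarrow> 'a \<Rightarrow> real"
    and JJ :: "nat set set" and J :: "nat set"
    and q r m l :: real
    and s_hat :: "nat \<Rightarrow> 'a list \<Rightarrow> real"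
    and phi_hat :: "nat \<Rightarrow> 'a list \<Rightarrow> 'a \<Rightarrow> real"
    and P_gen :: "nat \<Rightarrow> 'a list \<Rightarrow> 'a measure"
    and D :: "nat \<Rightarrow> 'a measure" and D_hat :: "nat \<Rightarrow> 'a list \<Rightarrow> 'a measure"
    and t s_est :: "nat \<Rightarrow> 'w \<Rightarrow> real" and phi_est :: "nat \<Rightarrow> 'w \<Rightarrow> 'a \<Rightarrow> real"
    and Q :: "nat \<Rightarrow> 'w \<Rightarrow> 'a measure" and u :: "nat \<Rightarrow> real"
    and Pi_true :: "nat \<Rightarrow> 'a measure" and Pi_est :: "nat \<Rightarrow> 'w \<Rightarrow> 'a measure"
    and \<kappa> :: real
  assumes t_def: "t = (\<lambda>n \<omega>. threshold q n (sample \<xi> n \<omega>))"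
    and s_est_def: "s_est = (\<lambda>n \<omega>. s_hat n (tail_sample q n (sample \<xi> n \<omega>)))"
    and phi_est_def: "phi_est = (\<lambda>n \<omega>. phi_hat n (tail_sample q n (sample \<xi> n \<omega>)))"
    and Q_def: "Q = (\<lambda>n \<omega>. P_gen n (sample \<xi> n \<omega>))"
    and u_def: "u = stress_level P r"
    and Pi_true_def: "Pi_true = (\<lambda>n. stressed_law (D n) P (u n) (stress_set E L (u n) J))"
    and Pi_est_def: "Pi_est = (\<lambda>n \<omega>.
           stressed_law (D_hat n (sample \<xi> n \<omega>)) (Q n \<omega>) (u n) (stress_set E L (u n) J))"
    and \<kappa>_def: "\<kappa> = min m l"
    and cone: "closed E" "cone E"
    and density: "supported_density E f" "P = density lborel f"
    and regular_variation: "density_regularly_varying E f s phi_star"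
    and second_order: "second_order_condition E f s phi_star \<gamma>"
    and losses: "asymptotically_homogeneous_system E K L Lstar"
    and collection: "JJ \<subseteq> Pow {1..K} - {{}}" "J \<in> JJ"
    and regular: "regular_system E Lstar JJ"
    and iid: "prob_space M" "prob_space.indep_vars M (\<lambda>_. borel) \<xi> {1..}"
      "\<And>i. i \<ge> 1 \<Longrightarrow> distr M borel (\<xi> i) = P"
    and parameters: "0 < q" "q < 1" "r \<ge> 1"
    and estimators_measurable:
      "\<And>n. n \<ge> 1 \<Longrightarrow> s_est n \<in> borel_measurable M"
      "\<And>n. n \<ge> 1 \<Longrightarrow> (\<lambda>(\<omega>, \<phi>). phi_est n \<omega> \<phi>) \<in> borel_measurable (M \<Otimes>\<^sub>M borel)"
    and estimators_admissible:
      "\<And>n. n \<ge> 1 \<Longrightarrow> AE \<omega> in M. s_est n \<omega> > 0 \<and>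
         (\<forall>\<phi>\<in>unit_directions E. phi_est n \<omega> \<phi> \<ge> 0) \<and>
         prob_space (density (surface_measure E) (phi_est n \<omega>))"
    and exponents: "0 < m" "m \<le> 1/2" "0 < l" "l \<le> 1/2"
    and radial_rate:
      "bigO_P M (\<lambda>n \<omega>. s_est n \<omega> - s) (\<lambda>n. real (num_exceed q n) powr (- m))"
    and angular_rate:
      "bigO_P M
         (\<lambda>n \<omega>. total_variation (angular_law P (t n \<omega>))
                   (density (surface_measure E) (phi_est n \<omega>)))
         (\<lambda>n. real (num_exceed q n) powr (- l))"
    and generator_measurable: "\<And>n. n \<ge> 1 \<Longrightarrow> Q n \<in> M \<rightarrow>\<^sub>M prob_algebra borel"
    and generator:
      "\<And>n. n \<ge> 1 \<Longrightarrow> AE \<omega> in M.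
         ssgen_law E (t n \<omega>) (real (num_exceed q n) / real n) (s_est n \<omega>) (phi_est n \<omega>) (Q n \<omega>)"
    and defaults: "\<And>n. prob_space (D n)" "\<And>n. sets (D n) = sets borel"
      "\<And>n xs. prob_space (D_hat n xs)" "\<And>n xs. sets (D_hat n xs) = sets borel"
  shows
    "bigO_P M (\<lambda>n \<omega>. total_variation (Pi_est n \<omega>) (Pi_true n))
       (\<lambda>n. real n powr (- ((1 - q) * \<kappa>)) + real n powr (- (q * \<gamma> / s))) \<and>
     (\<lambda>n. real n powr (- ((1 - q) * \<kappa>)) + real n powr (- (q * \<gamma> / s)))
       \<in> \<Theta>(\<lambda>n. real n powr (- rate_exponent s \<gamma> \<kappa> q)) \<and>
     0 < q_star s \<gamma> \<kappa> \<and> q_star s \<gamma> \<kappa> < 1 \<and>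
     (1 - q_star s \<gamma> \<kappa>) * \<kappa> = q_star s \<gamma> \<kappa> * \<gamma> / s \<and>
     (q = q_star s \<gamma> \<kappa> \<longrightarrow>
       bigO_P M (\<lambda>n \<omega>. total_variation (Pi_est n \<omega>) (Pi_true n))
         (\<lambda>n. real n powr (- (\<gamma> * \<kappa> / (\<gamma> + s * \<kappa>))))) \<and>
     (\<forall>q'. 0 < q' \<and> q' < 1 \<and> q' \<noteq> q_star s \<gamma> \<kappa> \<longrightarrow>
       rate_exponent s \<gamma> \<kappa> q' < rate_exponent s \<gamma> \<kappa> (q_star s \<gamma> \<kappa>))"
proof -
  interpret regularly_varying_model E P f phi_star s \<gamma>
    using cone density regular_variation second_order by unfold_locales
  have "\<kappa> > 0" "\<kappa> \<le> m" "\<kappa> \<le> l"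
    using exponents by (auto simp: \<kappa>_def)
  let ?a = "\<lambda>n. real n powr (- ((1 - q) * \<kappa>)) + real n powr (- (q * \<gamma> / s))"
  let ?X = "\<lambda>n \<omega>. total_variation (Pi_est n \<omega>) (Pi_true n)"

  \<comment> \<open>Upper bound in probability for an arbitrary fixed \<open>q\<close>\<close>
  have bound: "bigO_P M ?X ?a"
  proof -
    interpret M: prob_space M by (rule iid)
    interpret P: prob_space P by (rule prob_space_P)
    have J: "J \<subseteq> {1..K}" "J \<noteq> {}"
      using collection by auto
    then obtain j where j: "j \<in> J" "j \<in> {1..K}" by blast
    obtain c U where c: "c > 0" "\<And>u. U \<le> u \<Longrightarrow> stress_set E L u J \<subseteq> {x. norm x > c * u}"
      using stress_set_far[OF losses j \<open>cone E\<close>] by metis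
    have u_top: "filterlim u at_top sequentially"
      unfolding u_def using parameters by (intro stress_level_properties) auto
    obtain c0 where c0: "c0 > 0" "eventually (\<lambda>n. c0 \<le> u n powr s * measure P (stress_set E L (u n) J)) sequentially"
      using stress_set_mass[OF losses J _ u_top] regular collection unfolding regular_system_def by metis
    obtain C T where "C \<ge> 0" "T > 0"
      and dist: "\<And>v t p s' \<psi> Q S D D' u. \<lbrakk>T \<le> t; t \<le> v; 0 < p; 0 < s'; \<psi> \<in> borel_measurable borel;
        prob_space (density \<sigma> \<psi>); ssgen_law E t p s' \<psi> Q; S \<in> sets borel; S \<subseteq> {x. norm x > v};
        0 < measure P S; prob_space D; sets D = sets borel; prob_space D'; sets D' = sets borel\<rbrakk>
        \<Longrightarrow> total_variation (stressed_law D' Q u S) (stressed_law D P u S)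
          \<le> C * (t powr (- \<gamma>) + total_variation (angular_law P t) (density \<sigma> \<psi>) + \<bar>s' - s\<bar> / s')
            / (v powr s * measure P S)"
      and angular: "\<And>t. T \<le> t \<Longrightarrow> prob_space (angular_law P t)"
      using stressed_law_distance by blast
    obtain b where "b > 0"
      and threshold: "\<And>\<epsilon>. \<epsilon> > 0 \<Longrightarrow> \<forall>\<^sub>F n in sequentially. \<exists>A\<in>sets M. measure M A \<ge> 1 - \<epsilon> \<and>
        (\<forall>\<omega>\<in>A. b * real n powr (q / s) \<le> t n \<omega> \<and> t n \<omega> \<le> c * u n)"
    proof (rule threshold_in_probability[OF iid(1,2) _ parameters \<open>c > 0\<close>])
      show "distr M borel (\<xi> i) = P" if "1 \<le> i" for i
        using that by (rule iid(3))
    qed (rule that, unfold t_def u_def)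
    \<comment> \<open>The floor costs a factor 2 inside the power, which comes out as
      \<open>2 powr e \<le> 2\<close>; the exponent \<open>e\<close> may be lowered to
      \<open>\<kappa>\<close> because \<open>n \<ge> 1\<close>.\<close>
    have k_rate: "real (num_exceed q n) powr (- e) \<le> 2 * real n powr (- ((1 - q) * \<kappa>))"
      if "1 \<le> n" "\<kappa> \<le> e" "e \<le> 1 / 2" for n e
    proof -
      note k = num_exceed_bounds[OF parameters(1,2) \<open>1 \<le> n\<close>]
      have "e > 0" using that \<open>\<kappa> > 0\<close> by simp
      have "real (num_exceed q n) powr (- e) \<le> (real n powr (1 - q) / 2) powr (- e)"
        using k that \<open>e > 0\<close> by (intro powr_mono2') auto
      also have "\<dots> = 2 powr e * real n powr (- ((1 - q) * e))"
        using that by (simp add: powr_divide powr_powr powr_minus divide_simps)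
      also have "\<dots> \<le> 2 powr 1 * real n powr (- ((1 - q) * \<kappa>))"
        using that parameters \<open>e > 0\<close> by (intro mult_mono powr_mono) (auto intro: mult_left_mono)
      finally show ?thesis by simp
    qed
    show ?thesis
      unfolding bigO_P_def
    proof (intro allI impI)
      fix \<epsilon> :: real assume "\<epsilon> > 0"
      \<comment> \<open>Three events of probability at least \<open>1 - \<epsilon> / 3\<close> will
        be intersected: one for each estimation rate and one for the threshold bounds. The
        almost-sure properties cost nothing.\<close>
      then have "\<epsilon> / 3 > 0" by simp
      obtain C1 where C1: "\<forall>\<^sub>F n in sequentially. \<exists>A\<in>sets M. measure M A \<ge> 1 - \<epsilon> / 3
          \<and> (\<forall>\<omega>\<in>A. \<bar>s_est n \<omega> - s\<bar> \<le> C1 * real (num_exceed q n) powr (- m))"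
        using radial_rate \<open>\<epsilon> / 3 > 0\<close> unfolding bigO_P_def by blast
      obtain C2 where C2: "\<forall>\<^sub>F n in sequentially. \<exists>A\<in>sets M. measure M A \<ge> 1 - \<epsilon> / 3
          \<and> (\<forall>\<omega>\<in>A. \<bar>total_variation (angular_law P (t n \<omega>)) (density \<sigma> (phi_est n \<omega>))\<bar>
            \<le> C2 * real (num_exceed q n) powr (- l))"
        using angular_rate \<open>\<epsilon> / 3 > 0\<close> unfolding bigO_P_def by blast
      \<comment> \<open>One summand for each source: the lower bound on the threshold raised to
        \<open>- \<gamma>\<close>, the angular rate, and the radial rate divided by at least
        \<open>s / 2\<close>. Absolute values appear because \<open>bigO_P\<close> does not fix the
        sign of its constant.\<close>
      define H where "H = b powr (- \<gamma>) + 2 * \<bar>C2\<bar> + 4 * \<bar>C1\<bar> / s"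
      have "H \<ge> 0" using s_pos by (simp add: H_def)
      have "(\<lambda>n. 2 * \<bar>C1\<bar> * real n powr (- ((1 - q) * \<kappa>))) \<longlonglongrightarrow> 0"
        using parameters \<open>\<kappa> > 0\<close>
        by (intro tendsto_mult_right_zero tendsto_neg_powr filterlim_real_sequentially) auto
      \<comment> \<open>Keeps the estimated index at least \<open>s / 2\<close>, so that dividing by
        it is harmless.\<close>
      then have ev_s: "eventually (\<lambda>n. 2 * \<bar>C1\<bar> * real n powr (- ((1 - q) * \<kappa>)) < s / 2) sequentially"
        using s_pos by (intro order_tendstoD) auto
      have "filterlim (\<lambda>n. b * real n powr (q / s)) at_top sequentially"
        using parameters s_pos \<open>b > 0\<close> by real_asymp
      then have ev_T: "eventually (\<lambda>n. T \<le> b * real n powr (q / s)) sequentially"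
        unfolding filterlim_at_top by blast
      have ev_u: "eventually (\<lambda>n. max U 1 \<le> u n) sequentially"
        using u_top unfolding filterlim_at_top by blast
      from C1 C2 threshold[OF \<open>\<epsilon> / 3 > 0\<close>] ev_s ev_T ev_u c0(2) eventually_ge_at_top[of 1]
      have "\<forall>\<^sub>F n in sequentially. \<exists>A\<in>sets M. measure M A \<ge> 1 - \<epsilon>
        \<and> (\<forall>\<omega>\<in>A. \<bar>?X n \<omega>\<bar> \<le> C * H / (c powr s * c0) * ?a n)"
      proof eventually_elim
        case (elim n)
        from elim(1) obtain A1 where A1: "A1 \<in> sets M" "measure M A1 \<ge> 1 - \<epsilon> / 3"
          "\<And>\<omega>. \<omega> \<in> A1 \<Longrightarrow> \<bar>s_est n \<omega> - s\<bar> \<le> C1 * real (num_exceed q n) powr (- m)" by blast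
        from elim(2) obtain A2 where A2: "A2 \<in> sets M" "measure M A2 \<ge> 1 - \<epsilon> / 3"
          "\<And>\<omega>. \<omega> \<in> A2 \<Longrightarrow> \<bar>total_variation (angular_law P (t n \<omega>)) (density \<sigma> (phi_est n \<omega>))\<bar>
            \<le> C2 * real (num_exceed q n) powr (- l)" by blast
        from elim(3) obtain A3 where A3: "A3 \<in> sets M" "measure M A3 \<ge> 1 - \<epsilon> / 3"
          "\<And>\<omega>. \<omega> \<in> A3 \<Longrightarrow> b * real n powr (q / s) \<le> t n \<omega> \<and> t n \<omega> \<le> c * u n" by blast
        have n: "n \<ge> 1" by fact
        have "AE \<omega> in M. s_est n \<omega> > 0 \<and> prob_space (density \<sigma> (phi_est n \<omega>))
            \<and> ssgen_law E (t n \<omega>) (real (num_exceed q n) / real n) (s_est n \<omega>) (phi_est n \<omega>) (Q n \<omega>)"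
          using estimators_admissible[OF n] generator[OF n] by eventually_elim auto
        then obtain A4 where A4: "A4 \<in> sets M" "measure M A4 = 1"
          "\<And>\<omega>. \<omega> \<in> A4 \<Longrightarrow> s_est n \<omega> > 0 \<and> prob_space (density \<sigma> (phi_est n \<omega>))
            \<and> ssgen_law E (t n \<omega>) (real (num_exceed q n) / real n) (s_est n \<omega>) (phi_est n \<omega>) (Q n \<omega>)"
          by (rule M.AE_obtain_event) blast
        let ?A = "((A1 \<inter> A2) \<inter> A3) \<inter> A4"
        have "measure M ?A \<ge> 1 - (((\<epsilon> / 3 + \<epsilon> / 3) + \<epsilon> / 3) + 0)"
          using A1 A2 A3 A4 by (intro M.prob_Int_ge) auto
        then have "measure M ?A \<ge> 1 - \<epsilon>" by simp
        moreover have "\<bar>?X n \<omega>\<bar> \<le> C * H / (c powr s * c0) * ?a n" if "\<omega> \<in> ?A" for \<omega>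
        proof -
          note k = num_exceed_bounds[OF parameters(1,2) n]
          have \<omega>: "\<omega> \<in> A1" "\<omega> \<in> A2" "\<omega> \<in> A3" "\<omega> \<in> A4" "\<omega> \<in> space M"
            using that A1 sets.sets_into_space by auto
          let ?TV = "total_variation (angular_law P (t n \<omega>)) (density \<sigma> (phi_est n \<omega>))"
          have t: "b * real n powr (q / s) \<le> t n \<omega>" "T \<le> t n \<omega>" "t n \<omega> \<le> c * u n"
            using A3(3)[OF \<omega>(3)] elim(5) by auto
          have s_est: "s_est n \<omega> > 0" and prob_phi: "prob_space (density \<sigma> (phi_est n \<omega>))"
            and gen: "ssgen_law E (t n \<omega>) (real (num_exceed q n) / real n) (s_est n \<omega>) (phi_est n \<omega>) (Q n \<omega>)"
            using A4(3)[OF \<omega>(4)] by auto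
          have meas: "phi_est n \<omega> \<in> borel_measurable borel"
            using measurable_Pair2[OF estimators_measurable(2)[OF n] \<omega>(5)] by simp
          have mass: "c0 \<le> u n powr s * measure P (stress_set E L (u n) J)" by fact
          have u: "U \<le> u n" "0 < u n" using elim(6) by auto
          have "0 < u n powr s * measure P (stress_set E L (u n) J)" using mass c0(1) by linarith
          then have P_pos: "0 < measure P (stress_set E L (u n) J)"
            by (simp add: zero_less_mult_iff)
          have Q: "prob_space (Q n \<omega>)" "sets (Q n \<omega>) = sets borel"
            using gen by (auto simp: ssgen_law_def)
          have "0 \<le> ?X n \<omega>"
            unfolding Pi_est_def Pi_true_def using Q defaults prob_space_P
            by (intro total_variation_nonneg prob_space_stressed_law) auto
          then have "\<bar>?X n \<omega>\<bar> = ?X n \<omega>" by simp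
          \<comment> \<open>Applied with \<open>v = c * u n\<close>, which the threshold does not
            exceed on \<open>A3\<close> and which every stressed point exceeds in norm.\<close>
          also have "\<dots> \<le> C * (t n \<omega> powr (- \<gamma>) + ?TV + \<bar>s_est n \<omega> - s\<bar> / s_est n \<omega>)
              / ((c * u n) powr s * measure P (stress_set E L (u n) J))"
            unfolding Pi_est_def Pi_true_def
            using t s_est meas prob_phi gen k n P_pos c(2)[OF u(1)] defaults
              stress_set_borel[OF losses J(1) closed_E]
            by (intro dist) auto
          also have "\<dots> \<le> C * (H * ?a n) / (c powr s * c0)"
          proof (intro frac_le mult_left_mono)
            have "b > 0" "real n > 0" using \<open>b > 0\<close> n by auto
            have "t n \<omega> powr (- \<gamma>) \<le> (b * real n powr (q / s)) powr (- \<gamma>)"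
              using t \<gamma>_pos \<open>b > 0\<close> n by (intro powr_mono2') auto
            also have "\<dots> = b powr (- \<gamma>) * real n powr (- (q * \<gamma> / s))"
              using \<open>b > 0\<close> by (simp add: powr_mult powr_powr)
            also have "\<dots> \<le> b powr (- \<gamma>) * ?a n"
              by (intro mult_left_mono) auto
            finally have 1: "t n \<omega> powr (- \<gamma>) \<le> b powr (- \<gamma>) * ?a n" .
            have "?TV \<le> \<bar>C2\<bar> * real (num_exceed q n) powr (- l)"
              using A2(3)[OF \<omega>(2)] mult_right_mono[OF abs_ge_self[of C2], of "real (num_exceed q n) powr (- l)"]
              by simp
            also have "\<dots> \<le> \<bar>C2\<bar> * (2 * real n powr (- ((1 - q) * \<kappa>)))"
              using n exponents \<open>\<kappa> \<le> l\<close> by (intro mult_left_mono k_rate) auto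
            also have "\<dots> \<le> \<bar>C2\<bar> * (2 * ?a n)"
              by (intro mult_left_mono) auto
            finally have 2: "?TV \<le> 2 * \<bar>C2\<bar> * ?a n" by (simp only: mult_ac)
            have "\<bar>s_est n \<omega> - s\<bar> \<le> \<bar>C1\<bar> * real (num_exceed q n) powr (- m)"
              using A1(3)[OF \<omega>(1)] mult_right_mono[OF abs_ge_self[of C1], of "real (num_exceed q n) powr (- m)"]
              by simp
            also have "\<dots> \<le> \<bar>C1\<bar> * (2 * real n powr (- ((1 - q) * \<kappa>)))"
              using n exponents \<open>\<kappa> \<le> m\<close> by (intro mult_left_mono k_rate) auto
            finally have close: "\<bar>s_est n \<omega> - s\<bar> \<le> 2 * \<bar>C1\<bar> * real n powr (- ((1 - q) * \<kappa>))"
              by simp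
            then have "s / 2 \<le> s_est n \<omega>" using elim(4) by linarith
            then have "\<bar>s_est n \<omega> - s\<bar> / s_est n \<omega> \<le> 2 * \<bar>C1\<bar> * real n powr (- ((1 - q) * \<kappa>)) / (s / 2)"
              using close s_pos by (intro frac_le) auto
            also have "\<dots> = 4 * \<bar>C1\<bar> / s * real n powr (- ((1 - q) * \<kappa>))"
              by simp
            also have "\<dots> \<le> 4 * \<bar>C1\<bar> / s * ?a n"
              using s_pos by (intro mult_left_mono) auto
            finally have 3: "\<bar>s_est n \<omega> - s\<bar> / s_est n \<omega> \<le> 4 * \<bar>C1\<bar> / s * ?a n" .
            show "t n \<omega> powr (- \<gamma>) + ?TV + \<bar>s_est n \<omega> - s\<bar> / s_est n \<omega> \<le> H * ?a n"
              using 1 2 3 unfolding H_def distrib_right[of _ _ "?a n"] by linarith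
            \<comment> \<open>The stress mass decays no faster than \<open>u n powr (- s)\<close>,
              so the normaliser \<open>(c * u n) powr s\<close> keeps the denominator away from
              0.\<close>
            have "c powr s * c0 \<le> c powr s * (u n powr s * measure P (stress_set E L (u n) J))"
              using mass by (intro mult_left_mono) auto
            then show "c powr s * c0 \<le> (c * u n) powr s * measure P (stress_set E L (u n) J)"
              using c(1) u by (simp add: powr_mult mult.assoc)
            show "0 \<le> C * (H * ?a n)"
              using \<open>C \<ge> 0\<close> \<open>H \<ge> 0\<close> by (intro mult_nonneg_nonneg) auto
            show "0 < c powr s * c0" using c c0 by simp
          qed fact
          finally show ?thesis by (simp add: mult.assoc)
        qed
        moreover have "?A \<in> sets M" using A1 A2 A3 A4 by auto
        ultimately show ?case by blast
      qed
      then show "\<exists>C. \<forall>\<^sub>F n in sequentially. \<exists>A\<in>sets M. measure M A \<ge> 1 - \<epsilon>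
        \<and> (\<forall>\<omega>\<in>A. \<bar>?X n \<omega>\<bar> \<le> C * ?a n)" by blast
    qed
  qed
  \<comment> \<open>A sum of two nonnegative terms lies between the larger and twice the larger, and
    for \<open>n \<ge> 1\<close> the larger power is the one whose decay exponent is the
    minimum.\<close>
  have rate: "?a \<in> \<Theta>(\<lambda>n. real n powr (- rate_exponent s \<gamma> \<kappa> q))"
  proof (rule bigthetaI')
    show "eventually (\<lambda>n. 1 * norm (real n powr (- rate_exponent s \<gamma> \<kappa> q)) \<le> norm (?a n)
        \<and> norm (?a n) \<le> 2 * norm (real n powr (- rate_exponent s \<gamma> \<kappa> q))) sequentially"
      using eventually_ge_at_top[of 1]
    proof eventually_elim
      case (elim n)
      have "real n powr (- ((1 - q) * \<kappa>)) \<le> real n powr (- rate_exponent s \<gamma> \<kappa> q)"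
        "real n powr (- (q * \<gamma> / s)) \<le> real n powr (- rate_exponent s \<gamma> \<kappa> q)"
        using elim by (auto intro!: powr_mono simp: rate_exponent_def)
      moreover have "real n powr (- rate_exponent s \<gamma> \<kappa> q) \<le> ?a n"
        by (auto simp: rate_exponent_def min_def)
      ultimately show ?case by simp
    qed
  qed simp_all

  \<comment> \<open>The balancing exponent and its optimality\<close>
  have denom: "\<gamma> + s * \<kappa> > 0"
    using s_pos \<gamma>_pos \<open>\<kappa> > 0\<close> by (intro add_pos_pos mult_pos_pos)
  have q_star: "0 < q_star s \<gamma> \<kappa>" "q_star s \<gamma> \<kappa> < 1"
    using s_pos \<gamma>_pos \<open>\<kappa> > 0\<close> denom by (simp_all add: q_star_def)
  have balance: "(1 - q_star s \<gamma> \<kappa>) * \<kappa> = \<gamma> * \<kappa> / (\<gamma> + s * \<kappa>)"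
    "q_star s \<gamma> \<kappa> * \<gamma> / s = \<gamma> * \<kappa> / (\<gamma> + s * \<kappa>)"
  proof -
    have "1 - q_star s \<gamma> \<kappa> = \<gamma> / (\<gamma> + s * \<kappa>)"
      using denom unfolding q_star_def by (subst eq_divide_eq) (simp add: left_diff_distrib)
    then show "(1 - q_star s \<gamma> \<kappa>) * \<kappa> = \<gamma> * \<kappa> / (\<gamma> + s * \<kappa>)"
      by simp
    show "q_star s \<gamma> \<kappa> * \<gamma> / s = \<gamma> * \<kappa> / (\<gamma> + s * \<kappa>)"
      using s_pos by (simp add: q_star_def mult.commute)
  qed
  have "bigO_P M ?X (\<lambda>n. real n powr (- (\<gamma> * \<kappa> / (\<gamma> + s * \<kappa>))))" if "q = q_star s \<gamma> \<kappa>"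
  proof -
    \<comment> \<open>At the balancing \<open>q\<close> the two powers coincide, and the resulting
      factor 2 is absorbed into the constant of \<open>bigO_P\<close>.\<close>
    have a: "?a n = 2 * real n powr (- (\<gamma> * \<kappa> / (\<gamma> + s * \<kappa>)))" for n
      unfolding that balance by simp
    have "\<exists>C. \<forall>\<^sub>F n in sequentially. \<exists>A\<in>sets M. measure M A \<ge> 1 - \<epsilon>
        \<and> (\<forall>\<omega>\<in>A. \<bar>?X n \<omega>\<bar> \<le> C * real n powr (- (\<gamma> * \<kappa> / (\<gamma> + s * \<kappa>))))" if "\<epsilon> > 0" for \<epsilon>
    proof -
      obtain C where "\<forall>\<^sub>F n in sequentially. \<exists>A\<in>sets M. measure M A \<ge> 1 - \<epsilon>
        \<and> (\<forall>\<omega>\<in>A. \<bar>?X n \<omega>\<bar> \<le> C * ?a n)"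
        using bound \<open>\<epsilon> > 0\<close> unfolding bigO_P_def by blast
      then show ?thesis
        unfolding a mult.assoc[symmetric] by blast
    qed
    then show ?thesis unfolding bigO_P_def by blast
  qed
  \<comment> \<open>In \<open>q'\<close> the first term of the minimum strictly decreases and the
    second strictly increases, and at \<open>q_star\<close> they agree; moving to either side lowers
    one of them below the common value.\<close>
  moreover have "rate_exponent s \<gamma> \<kappa> q' < rate_exponent s \<gamma> \<kappa> (q_star s \<gamma> \<kappa>)"
    if "q' \<noteq> q_star s \<gamma> \<kappa>" for q'
  proof (cases "q' < q_star s \<gamma> \<kappa>")
    case True
    then have "q' * \<gamma> / s < q_star s \<gamma> \<kappa> * \<gamma> / s"
      using s_pos \<gamma>_pos by (intro divide_strict_right_mono mult_strict_right_mono)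
    then show ?thesis
      unfolding rate_exponent_def balance by simp
  next
    case False
    with that have "(1 - q') * \<kappa> < (1 - q_star s \<gamma> \<kappa>) * \<kappa>"
      using \<open>\<kappa> > 0\<close> by (intro mult_strict_right_mono) auto
    then show ?thesis
      unfolding rate_exponent_def balance by simp
  qed
  ultimately show ?thesis
    using bound rate q_star balance by simp
qed

end
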